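(* Let $\Omega$ be a smooth bounded domain in $\mathbb{R}^N$, $N\ge 2$, and let $f(u)=e^u$. Suppose \[ N < 2 + 4\sqrt{2} + 4\sqrt{2-\sqrt{2}} \approx 10.718. \] Then the extremal solution $u^*$ associated with the problem $(N)_{\lambda^*}$: $\Delta^2 u=\lambda^* f(u)$ in $\Omega$, $u=\Delta u=0$ on $\partial\Omega$, is bounded (i.e. $u^*\in L^\infty(\Omega)$).
   Context: For $\lambda\ge 0$, $(N)_\lambda$ denotes the fourth order Navier problem \[ \Delta^2 u=\lambda f(u)\ \text{ in }\Omega,\qquad u=\Delta u=0\ \text{ on }\partial\Omega, \] here with $f(u)=e^u$. A smooth solution $u$ of $(N)_\lambda$ is called minimal if $u\le v$ a.e. in $\Omega$ for any solution $v$ of $(N)_\lambda$. The extremal parameter is $\lambda^*:=\sup\{\lambda>0:\ \text{there exists a smooth solution of }(N)_\lambda\}$. It is known that $0<\lambda^*<\infty$, that for each $0<\lambda<\lambda^*$ there exists a smooth minimal solution $u_\lambda$ of $(N)_\lambda$, and that for each $x\in\Omega$ the map $\lambda\mapsto u_\lambda(x)$ is strictly increasing on $(0,\lambda^* )$. The extremal solution is defined by $u^*(x):=\lim_{\lambda\nearrow\lambda^*}u_\lambda(x)$ for $x\in\Omega$. *)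

theory Defs
  imports "HOL-Analysis.Analysis"
begin

text \<open>
  Partial derivatives are total functions here; they carry meaning only at points of
  differentiability. All uses below are on open sets where the function is required to be smooth.
\<close>

definition partial_deriv :: "'a::euclidean_space \<Rightarrow> ('a \<Rightarrow> real) \<Rightarrow> 'a \<Rightarrow> real" where
  "partial_deriv e f x = frechet_derivative f (at x) e"

definition iterated_partial :: "'a::euclidean_space list \<Rightarrow> ('a \<Rightarrow> real) \<Rightarrow> 'a \<Rightarrow> real" where
  "iterated_partial es f = foldr partial_deriv es f"

definition laplacian :: "('a::euclidean_space \<Rightarrow> real) \<Rightarrow> 'a \<Rightarrow> real" where
  "laplacian f x = (\<Sum>e\<in>Basis. partial_deriv e (partial_deriv e f) x)"

text \<open>
  \<open>C\<^sup>\<infinity>(S)\<close> for open \<open>S\<close>: every iterated coordinate partial derivative, including the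
  function itself, is (Frechet) differentiable on \<open>S\<close>, hence also continuous there.
\<close>

definition smooth_on :: "'a::euclidean_space set \<Rightarrow> ('a \<Rightarrow> real) \<Rightarrow> bool" where
  "smooth_on S f \<longleftrightarrow> (\<forall>es\<in>lists Basis. iterated_partial es f differentiable_on S)"

text \<open>
  \<open>C\<^sup>\<infinity>\<close> up to the boundary of an open set: all partial derivatives of all orders extend
  continuously to the closure, and the values of the function itself on the boundary are those
  of its continuous extension.
\<close>

definition smooth_on_closure :: "'a::euclidean_space set \<Rightarrow> ('a \<Rightarrow> real) \<Rightarrow> bool" where
  "smooth_on_closure \<Omega> f \<longleftrightarrow>
     smooth_on \<Omega> f \<and> continuous_on (closure \<Omega>) f \<and>
     (\<forall>es\<in>lists Basis. \<exists>g. continuous_on (closure \<Omega>) g \<and> (\<forall>x\<in>\<Omega>. g x = iterated_partial es f x))"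

text \<open>
  Near every boundary point the set is the strict epigraph of a smooth function over a hyperplane.
  Here \<open>e\<close> is the vertical unit direction and \<open>x - (x \<bullet> e) *\<^sub>R e\<close> the
  projection of \<open>x\<close> to the hyperplane orthogonal to \<open>e\<close>; only the values of \<open>\<gamma>\<close> on
  that hyperplane matter.
\<close>

definition smooth_boundary :: "'a::euclidean_space set \<Rightarrow> bool" where
  "smooth_boundary \<Omega> \<longleftrightarrow>
     (\<forall>x0\<in>frontier \<Omega>. \<exists>r>0. \<exists>e \<gamma>. norm e = 1 \<and> smooth_on UNIV \<gamma> \<and>
        \<Omega> \<inter> ball x0 r = {x \<in> ball x0 r. \<gamma> (x - (x \<bullet> e) *\<^sub>R e) < x \<bullet> e})"

definition smooth_bounded_domain :: "'a::euclidean_space set \<Rightarrow> bool" where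
  "smooth_bounded_domain \<Omega> \<longleftrightarrow>
     open \<Omega> \<and> connected \<Omega> \<and> \<Omega> \<noteq> {} \<and> bounded \<Omega> \<and> smooth_boundary \<Omega>"

text \<open>
  Smooth solutions of \<open>\<Delta>\<^sup>2 u = \<lambda> f(u)\<close> in \<open>\<Omega>\<close> with \<open>u = \<Delta>u = 0\<close> on the boundary. The
  boundary values of \<open>\<Delta>u\<close> are those of its continuous extension from \<open>\<Omega>\<close>.
\<close>

definition navier_solution ::
    "(real \<Rightarrow> real) \<Rightarrow> 'a::euclidean_space set \<Rightarrow> real \<Rightarrow> ('a \<Rightarrow> real) \<Rightarrow> bool" where
  "navier_solution f \<Omega> l u \<longleftrightarrow>
     smooth_on_closure \<Omega> u \<and>
     (\<forall>x\<in>\<Omega>. laplacian (laplacian u) x = l * f (u x)) \<and>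
     (\<forall>x\<in>frontier \<Omega>. u x = 0 \<and> (laplacian u \<longlongrightarrow> 0) (at x within \<Omega>))"

definition minimal_navier_solution ::
    "(real \<Rightarrow> real) \<Rightarrow> 'a::euclidean_space set \<Rightarrow> real \<Rightarrow> ('a \<Rightarrow> real) \<Rightarrow> bool" where
  "minimal_navier_solution f \<Omega> l u \<longleftrightarrow>
     navier_solution f \<Omega> l u \<and>
     (\<forall>v. navier_solution f \<Omega> l v \<longrightarrow> (AE x in lebesgue_on \<Omega>. u x \<le> v x))"

text \<open>The supremum is taken in the extended reals, so that it is meaningful without
  presupposing that it is finite.\<close>

definition extremal_parameter ::
    "(real \<Rightarrow> real) \<Rightarrow> 'a::euclidean_space set \<Rightarrow> ereal" where
  "extremal_parameter f \<Omega> = (SUP l \<in> {l. 0 < l \<and> (\<exists>u. navier_solution f \<Omega> l u)}. ereal l)"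

text \<open>
  The increasing pointwise limit of the branch \<open>u\<close> of minimal solutions as the parameter
  increases to \<open>L\<close>. It may be infinite at some points, hence the extended real values.
\<close>

definition is_extremal_solution ::
    "real \<Rightarrow> 'a::euclidean_space set \<Rightarrow> (real \<Rightarrow> 'a \<Rightarrow> real) \<Rightarrow> ('a \<Rightarrow> ereal) \<Rightarrow> bool" where
  "is_extremal_solution L \<Omega> u ustar \<longleftrightarrow>
     (\<forall>x\<in>\<Omega>. ((\<lambda>l. ereal (u l x)) \<longlongrightarrow> ustar x) (at_left L))"

definition in_L_infinity :: "'a::euclidean_space set \<Rightarrow> ('a \<Rightarrow> ereal) \<Rightarrow> bool" where
  "in_L_infinity \<Omega> g \<longleftrightarrow>
     g \<in> borel_measurable (lebesgue_on \<Omega>) \<and>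
     (\<exists>M::real. AE x in lebesgue_on \<Omega>. \<bar>g x\<bar> \<le> ereal M)"

end

theory Submission
  imports Defs
begin

text \<open>
  Put \<open>v = -\<Delta>u\<close>. The difference of two members of the strictly increasing branch is positive and, by
  convexity of \<open>exp\<close>, a supersolution of the linearised problem. This gives the stability inequality
  \<open>\<integral> (\<lambda> exp u)\<^sup>1\<^sup>/\<^sup>2 \<eta>\<^sup>2 \<le> \<integral> |\<nabla>\<eta>|\<^sup>2\<close>, while the minimum principle gives
  \<open>v \<ge> (2\<lambda>)\<^sup>1\<^sup>/\<^sup>2 (exp (u/2) - 1)\<close>. Choosing \<open>\<eta> = (v - 1)\<^sub>+\<^sup>\<alpha>\<close> and testing the equation of \<open>v\<close> with a
  power of \<open>(v - 1)\<^sub>+\<close>, everything closes as long as \<open>\<alpha>\<^sup>2 < \<surd>2 (2\<alpha> - 1)\<close>, that is, for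
  \<open>\<alpha> < \<surd>2 + \<surd>(2 - \<surd>2)\<close> (and above the smaller root), and bounds \<open>exp u\<close> in \<open>L\<^sup>p\<close> for \<open>p = \<alpha> + 1/2\<close>,
  uniformly in \<open>\<lambda>\<close>. The hypothesis on the dimension \<open>N\<close> is exactly that some such \<open>p\<close> exceeds
  \<open>N/4\<close>; as it means \<open>N \<le> 10\<close>, the single exponent \<open>\<alpha> = 21/10\<close> suffices. Estimates by Riesz potentials
  then bound \<open>v\<close> by \<open>exp u\<close> and \<open>u\<close> by \<open>v\<close>, hence \<open>u\<close> uniformly.

  All test functions vanish where \<open>u\<close> or \<open>v\<close> is at most \<open>1\<close>, so they have compact support in the domain and
  the regularity of the boundary plays no role.
\<close>

subsection \<open>Calculus with gradients\<close>

text \<open>The condition on \<alpha> comes from eliminating a gradient term. With rho =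
  sqrt(\<lambda> exp u) and s = (v - 1)_+, stability bounds \<integral> rho s^(2\<alpha>) by
  \<alpha>^2 \<integral> s^(2\<alpha>-2) |\<nabla>v|^2, and the equation of v turns (2\<alpha> - 1)
  times this last integral into \<integral> rho^2 s^(2\<alpha>-1). The pointwise bound reads rho
  \<le> v / sqrt 2 + sqrt \<lambda>, so up to lower order this is at most 1 / sqrt 2 times the first
  integral, which is absorbed when \<alpha>^2 / (2\<alpha> - 1) < sqrt 2. What is then controlled is
  rho^(2\<alpha>+1) = (\<lambda> exp u)^(\<alpha>+1/2).

  The threshold N/4 is the integrability of the kernel |x|^(4-N) of the inverse bi-Laplacian against
  an L^p source. For N = 10 it asks for \<alpha> > 2, while the absorption allows \<alpha> up to
  about 2.179; 21/10 lies between. All exponents below derive from it: \<alpha> - 1 = 11/10,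
  2\<alpha> - 2 = 11/5, 2\<alpha> - 1 = 16/5, 2\<alpha> = 21/5, p = 13/5, 2p = 26/5.\<close>

lemma DERIV_truncate:
  fixes g g' :: "real \<Rightarrow> real"
  assumes der: "\<And>t. 0 \<le> t \<Longrightarrow> (g has_real_derivative g' t) (at t within {0..})"
    and "g' 0 = 0"
  shows "((\<lambda>t. g (max 0 t)) has_real_derivative g' (max 0 t)) (at t)"
proof (cases t "0::real" rule: linorder_cases)
  case less
  have "((\<lambda>t. g 0) has_real_derivative 0) (at t)"
    by simp
  moreover have "eventually (\<lambda>s. s \<in> {..<0::real}) (nhds t)"
    using less by (intro eventually_nhds_in_open) auto
  then have "eventually (\<lambda>s. g (max 0 s) = g 0) (nhds t)"
    by eventually_elim auto
  ultimately show ?thesis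
    using less \<open>g' 0 = 0\<close> by (subst DERIV_cong_ev[where g="\<lambda>_. g 0"]) auto
next
  case greater
  have "(g has_real_derivative g' t) (at t)"
    using der[of t] greater at_within_interior[of t "{0..}"] by simp
  moreover have "eventually (\<lambda>s. s \<in> {0<..}) (nhds t)"
    using greater by (intro eventually_nhds_in_open) auto
  then have "eventually (\<lambda>s. g (max 0 s) = g s) (nhds t)"
    by eventually_elim auto
  ultimately show ?thesis
    using greater by (subst DERIV_cong_ev[where g=g and v="g' t" and y=t]) auto
next
  case equal
  \<comment> \<open>At the gluing point the two one-sided derivatives are treated separately:
    \<open>g' 0\<close> on the right, 0 on the constant left branch. They agree because
    \<open>g' 0 = 0\<close>.\<close>
  have "((\<lambda>t. g (max 0 t)) has_real_derivative 0) (at 0 within {0..})"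
    by (rule has_field_derivative_transform_within[OF der[of 0, unfolded \<open>g' 0 = 0\<close>], of 1]) auto
  moreover have "((\<lambda>t. g (max 0 t)) has_real_derivative 0) (at 0 within {..0})"
    by (rule has_field_derivative_transform_within[where f="\<lambda>_. g 0" and d=1]) auto
  ultimately have "((\<lambda>t. g (max 0 t)) has_real_derivative 0) (at 0 within {0..} \<union> {..0})"
    unfolding has_field_derivative_iff Lim_within_Un by simp
  moreover have "{0..} \<union> {..0::real} = UNIV" by auto
  ultimately show ?thesis
    using equal \<open>g' 0 = 0\<close> by simp
qed

lemma DERIV_max_powr:
  fixes r :: real
  assumes "1 < r"
  shows "((\<lambda>t. max 0 t powr r) has_real_derivative r * max 0 t powr (r - 1)) (at t)"
proof (rule DERIV_truncate[where g="\<lambda>t. t powr r" and g'="\<lambda>t. r * t powr (r - 1)"])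
  fix t :: real assume "0 \<le> t"
  show "((\<lambda>t. t powr r) has_real_derivative r * t powr (r - 1)) (at t within {0..})"
  proof (cases "t = 0")
    case False
    then show ?thesis
      using \<open>0 \<le> t\<close> by (intro has_field_derivative_at_within[OF has_real_derivative_powr]) simp
  next
    case True
    \<comment> \<open>At 0 the difference quotient of the power is \<open>h powr (r - 1)\<close>,
      which tends to 0 because the exponent is positive.\<close>
    have "((\<lambda>h::real. h powr (r - 1)) \<longlongrightarrow> 0 powr (r - 1)) (at 0 within {0..})"
      using \<open>1 < r\<close>
      by (intro tendsto_powr2[OF tendsto_ident_at tendsto_const]) (simp_all add: eventually_at_filter)
    then have "((\<lambda>h::real. h powr (r - 1)) \<longlongrightarrow> 0) (at 0 within {0..})"
      using \<open>1 < r\<close> by simp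
    then have "((\<lambda>h::real. (h powr r - 0 powr r) / (h - 0)) \<longlongrightarrow> 0) (at 0 within {0..})"
      by (rule Lim_transform_eventually) (simp add: eventually_at_filter powr_diff)
    then show ?thesis
      unfolding has_field_derivative_iff using True by simp
  qed
qed simp

lemma continuous_max_powr:
  fixes r :: real
  assumes "0 < r" "continuous_on S f"
  shows "continuous_on S (\<lambda>x. max 0 (f x) powr r)"
  using assms by (intro continuous_on_powr' continuous_intros) auto

lemma GDERIV_cong:
  assumes "GDERIV f x :> D" "open S" "x \<in> S" "\<And>y. y \<in> S \<Longrightarrow> f y = g y"
  shows "GDERIV g x :> D"
  using assms unfolding gderiv_def
  by (intro has_derivative_transform_within_open[OF assms(1)[unfolded gderiv_def]]) auto

lemma GDERIV_imp_continuous_on: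
  assumes "\<And>x. x \<in> S \<Longrightarrow> GDERIV f x :> D x"
  shows "continuous_on S f"
  using assms unfolding gderiv_def
  by (intro has_derivative_continuous_on[where f'="\<lambda>x h. inner h (D x)"])
     (auto intro: has_derivative_at_withinI)

lemma GDERIV_zero_outside_support:
  assumes "closed K" "x \<notin> K" "\<And>y. y \<notin> K \<Longrightarrow> f y = 0"
  shows "GDERIV f x :> 0"
  by (rule GDERIV_cong[where S="-K", OF GDERIV_const[of 0]]) (use assms in auto)

lemma GDERIV_line:
  assumes "GDERIV f (x + t *\<^sub>R e) :> D"
  shows "((\<lambda>t. f (x + t *\<^sub>R e)) has_real_derivative (D \<bullet> e)) (at t)"
proof -
  have "((\<lambda>t. x + t *\<^sub>R e) has_derivative (\<lambda>h. h *\<^sub>R e)) (at t)"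
    by (auto intro!: derivative_eq_intros)
  from has_derivative_compose[OF this assms[unfolded gderiv_def]]
  show ?thesis
    by (simp add: has_field_derivative_def inner_commute mult.commute[of "D \<bullet> e"] mult_commute_abs)
qed

section \<open>Derivatives of compactly supported functions integrate to zero\<close>

text \<open>The translates of \<open>h\<close> in the direction \<open>e\<close> all have the same integral, so the
  difference quotients integrate to \<open>0\<close>; the derivative inherits this by dominated
  convergence.\<close>

lemma integral_directional_derivative_eq_0:
  fixes h :: "'a::euclidean_space \<Rightarrow> real"
  assumes "compact K" and zero: "\<And>x. x \<notin> K \<Longrightarrow> h x = 0"
    and der: "\<And>x. GDERIV h x :> D x" and bound: "\<And>x. \<bar>D x \<bullet> e\<bar> \<le> B"
  shows "integrable lborel (\<lambda>x. D x \<bullet> e)" "integral\<^sup>L lborel (\<lambda>x. D x \<bullet> e) = 0"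
proof -
  obtain R where R: "K \<subseteq> cball 0 R"
    using compact_imp_bounded[OF \<open>compact K\<close>] unfolding bounded_iff by (auto simp: subset_iff)
  \<comment> \<open>Steps of length at most 1 keep the supports of all difference quotients in one
    ball of radius \<open>R + norm e\<close>; there the mean value theorem bounds them by
    \<open>B\<close>.\<close>
  define t where "t n = 1 / real (Suc n)" for n
  have t: "0 < t n" "t n \<le> 1" for n
    by (auto simp: t_def)
  have t0: "filterlim t (at 0) sequentially"
    unfolding t_def filterlim_at
    using LIMSEQ_inverse_real_of_nat by (auto simp: inverse_eq_divide)
  define q where "q n x = (h (x + t n *\<^sub>R e) - h x) / t n" for n x
  have cont: "continuous_on UNIV h"
    by (rule GDERIV_imp_continuous_on) (rule der)
  then have meas_h[measurable]: "h \<in> borel_measurable borel"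
    by (rule borel_measurable_continuous_onI)
  have int_h: "integrable lborel h"
  proof -
    have "integrable lborel (\<lambda>x. indicator K x *\<^sub>R h x)"
      by (rule borel_integrable_compact[OF \<open>compact K\<close> continuous_on_subset[OF cont]]) simp
    also have "(\<lambda>x. indicator K x *\<^sub>R h x) = h"
      using zero by (auto simp: indicator_def fun_eq_iff)
    finally show ?thesis .
  qed
  have shift: "integrable lborel (\<lambda>x. h (x + c))"
      "integral\<^sup>L lborel (\<lambda>x. h (x + c)) = integral\<^sup>L lborel h" for c
  proof -
    have "integrable (distr lborel borel ((+) c)) h"
      using int_h by (simp add: lborel_distr_plus)
    then show "integrable lborel (\<lambda>x. h (x + c))"
      by (subst (asm) integrable_distr_eq) (auto simp: add.commute)
    have "integral\<^sup>L lborel h = integral\<^sup>L (distr lborel borel ((+) c)) h"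
      by (simp add: lborel_distr_plus)
    also have "\<dots> = integral\<^sup>L lborel (\<lambda>x. h (c + x))"
      by (rule integral_distr) auto
    finally show "integral\<^sup>L lborel (\<lambda>x. h (x + c)) = integral\<^sup>L lborel h"
      by (simp add: add.commute)
  qed
  have q_int: "integral\<^sup>L lborel (q n) = 0" for n
    unfolding q_def using shift int_h by (simp add: integral_divide_zero)
  have q_lim: "(\<lambda>n. q n x) \<longlonglongrightarrow> D x \<bullet> e" for x
  proof -
    have "((\<lambda>t. h (x + t *\<^sub>R e)) has_real_derivative (D x \<bullet> e)) (at 0)"
      by (rule GDERIV_line) (simp add: der)
    then have "((\<lambda>t. (h (x + t *\<^sub>R e) - h x) / t) \<longlongrightarrow> D x \<bullet> e) (at 0)"
      by (simp add: has_field_derivative_iff)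
    from filterlim_compose[OF this t0] show ?thesis
      by (simp add: q_def)
  qed
  have q_bound: "norm (q n x) \<le> B * indicator (cball 0 (R + norm e)) x" for n x
  proof (cases "x \<in> cball 0 (R + norm e)")
    case True
    obtain z where "h (x + t n *\<^sub>R e) - h (x + 0 *\<^sub>R e) = (t n - 0) * (D (x + z *\<^sub>R e) \<bullet> e)"
      using MVT2[of 0 "t n" "\<lambda>s. h (x + s *\<^sub>R e)" "\<lambda>z. D (x + z *\<^sub>R e) \<bullet> e"] t[of n]
        GDERIV_line[OF der] by blast
    then have "q n x = D (x + z *\<^sub>R e) \<bullet> e"
      using t[of n] by (simp add: q_def)
    then show ?thesis
      using True bound by simp
  next
    case False
    have "norm (x + t n *\<^sub>R e) \<ge> norm x - norm (t n *\<^sub>R e)"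
      by (metis norm_diff_ineq)
    moreover have "norm (t n *\<^sub>R e) \<le> norm e"
      using t[of n] by (simp add: mult_left_le_one_le)
    ultimately have "x + t n *\<^sub>R e \<notin> K" "x \<notin> K"
      using False R norm_ge_zero[of e] by (auto simp: subset_iff) (smt (verit) norm_ge_zero)+
    then show ?thesis
      using False by (simp add: q_def zero)
  qed
  have dom: "integrable lborel (\<lambda>x::'a. B * indicator (cball 0 (R + norm e)) x :: real)"
    using emeasure_bounded_finite[OF bounded_cball, of "0::'a" "R + norm e"]
    by (intro integrable_mult_right integrable_real_indicator) auto
  have [measurable]: "q n \<in> borel_measurable lborel" for n
    unfolding q_def by measurable
  have [measurable]: "(\<lambda>x. D x \<bullet> e) \<in> borel_measurable lborel"
    by (rule borel_measurable_LIMSEQ_real[where u=q]) (auto simp: q_lim)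
  show "integrable lborel (\<lambda>x. D x \<bullet> e)"
    by (rule integrable_dominated_convergence[where s=q, OF _ _ dom]) (auto simp: q_lim intro!: AE_I2 q_bound[unfolded real_norm_def])
  have "(\<lambda>n. integral\<^sup>L lborel (q n)) \<longlonglongrightarrow> integral\<^sup>L lborel (\<lambda>x. D x \<bullet> e)"
    by (rule integral_dominated_convergence[where s=q, OF _ _ dom]) (auto simp: q_lim intro!: AE_I2 q_bound[unfolded real_norm_def])
  then show "integral\<^sup>L lborel (\<lambda>x. D x \<bullet> e) = 0"
    by (simp add: q_int LIMSEQ_const_iff)
qed

section \<open>Gradient and Laplacian, integration by parts\<close>

text \<open>Only the pure second derivatives are required to be continuous.\<close>

definition has_grad_lap ::
    "'a::euclidean_space set \<Rightarrow> ('a \<Rightarrow> real) \<Rightarrow> ('a \<Rightarrow> 'a) \<Rightarrow> ('a \<Rightarrow> real) \<Rightarrow> bool" where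
  "has_grad_lap S f G L \<longleftrightarrow> (\<forall>x\<in>S. GDERIV f x :> G x) \<and>
     (\<exists>H. (\<forall>e\<in>Basis. \<forall>x\<in>S. GDERIV (\<lambda>y. G y \<bullet> e) x :> H e x) \<and>
          (\<forall>e\<in>Basis. continuous_on S (\<lambda>x. H e x \<bullet> e)) \<and>
          (\<forall>x\<in>S. L x = (\<Sum>e\<in>Basis. H e x \<bullet> e)))"

lemma has_grad_lapD1: "has_grad_lap S f G L \<Longrightarrow> x \<in> S \<Longrightarrow> GDERIV f x :> G x"
  by (simp add: has_grad_lap_def)

lemma has_grad_lapE:
  assumes "has_grad_lap S f G L"
  obtains H where "\<And>e x. e \<in> Basis \<Longrightarrow> x \<in> S \<Longrightarrow> GDERIV (\<lambda>y. G y \<bullet> e) x :> H e x"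
    "\<And>e. e \<in> Basis \<Longrightarrow> continuous_on S (\<lambda>x. H e x \<bullet> e)"
    "\<And>x. x \<in> S \<Longrightarrow> L x = (\<Sum>e\<in>Basis. H e x \<bullet> e)"
  using assms unfolding has_grad_lap_def by blast

lemma has_grad_lap_continuous:
  assumes "has_grad_lap S f G L"
  shows "continuous_on S f" "continuous_on S G" "continuous_on S L"
proof -
  show "continuous_on S f"
    by (rule GDERIV_imp_continuous_on) (rule has_grad_lapD1[OF assms])
  obtain H where H: "\<And>e x. e \<in> Basis \<Longrightarrow> x \<in> S \<Longrightarrow> GDERIV (\<lambda>y. G y \<bullet> e) x :> H e x"
    "\<And>e. e \<in> Basis \<Longrightarrow> continuous_on S (\<lambda>x. H e x \<bullet> e)"
    "\<And>x. x \<in> S \<Longrightarrow> L x = (\<Sum>e\<in>Basis. H e x \<bullet> e)"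
    using has_grad_lapE[OF assms] by blast
  have "continuous_on S (\<lambda>x. G x \<bullet> e)" if "e \<in> Basis" for e
    using H(1)[OF that] by (rule GDERIV_imp_continuous_on)
  then show "continuous_on S G"
    by (subst continuous_on_componentwise) simp
  have "continuous_on S (\<lambda>x. \<Sum>e\<in>Basis. H e x \<bullet> e)"
    by (intro continuous_intros H)
  then show "continuous_on S L"
    using continuous_on_cong[of S S L "\<lambda>x. \<Sum>e\<in>Basis. H e x \<bullet> e"] H(3) by simp
qed

lemma has_grad_lap_cong:
  assumes "has_grad_lap S f G L" "open S"
    "\<And>x. x \<in> S \<Longrightarrow> f x = f' x" "\<And>x. x \<in> S \<Longrightarrow> L x = L' x"
  shows "has_grad_lap S f' G L'"
  using assms unfolding has_grad_lap_def
  by (auto intro: GDERIV_cong[OF _ \<open>open S\<close>])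

lemma has_grad_lap_add:
  assumes "has_grad_lap S f G L" "has_grad_lap S f' G' L'"
  shows "has_grad_lap S (\<lambda>x. f x + f' x) (\<lambda>x. G x + G' x) (\<lambda>x. L x + L' x)"
proof -
  obtain H where H: "\<And>e x. e \<in> Basis \<Longrightarrow> x \<in> S \<Longrightarrow> GDERIV (\<lambda>y. G y \<bullet> e) x :> H e x"
    "\<And>e. e \<in> Basis \<Longrightarrow> continuous_on S (\<lambda>x. H e x \<bullet> e)"
    "\<And>x. x \<in> S \<Longrightarrow> L x = (\<Sum>e\<in>Basis. H e x \<bullet> e)"
    using has_grad_lapE[OF assms(1)] by blast
  obtain H' where H': "\<And>e x. e \<in> Basis \<Longrightarrow> x \<in> S \<Longrightarrow> GDERIV (\<lambda>y. G' y \<bullet> e) x :> H' e x"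
    "\<And>e. e \<in> Basis \<Longrightarrow> continuous_on S (\<lambda>x. H' e x \<bullet> e)"
    "\<And>x. x \<in> S \<Longrightarrow> L' x = (\<Sum>e\<in>Basis. H' e x \<bullet> e)"
    using has_grad_lapE[OF assms(2)] by blast
  show ?thesis
    unfolding has_grad_lap_def
    using H H' assms[THEN has_grad_lapD1]
    by (intro conjI ballI exI[of _ "\<lambda>e x. H e x + H' e x"])
       (auto simp: inner_add_left sum.distrib intro!: GDERIV_add continuous_on_add)
qed

lemma has_grad_lap_compose:
  assumes f: "has_grad_lap S f G L"
    and g: "\<And>x. x \<in> S \<Longrightarrow> (g has_real_derivative g' (f x)) (at (f x))"
    and g': "\<And>x. x \<in> S \<Longrightarrow> (g' has_real_derivative g'' (f x)) (at (f x))"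
    and cont: "continuous_on S (\<lambda>x. g'' (f x))"
  shows "has_grad_lap S (\<lambda>x. g (f x)) (\<lambda>x. g' (f x) *\<^sub>R G x)
    (\<lambda>x. g'' (f x) * (G x \<bullet> G x) + g' (f x) * L x)"
proof -
  obtain H where H: "\<And>e x. e \<in> Basis \<Longrightarrow> x \<in> S \<Longrightarrow> GDERIV (\<lambda>y. G y \<bullet> e) x :> H e x"
    "\<And>e. e \<in> Basis \<Longrightarrow> continuous_on S (\<lambda>x. H e x \<bullet> e)"
    "\<And>x. x \<in> S \<Longrightarrow> L x = (\<Sum>e\<in>Basis. H e x \<bullet> e)"
    using has_grad_lapE[OF f] by blast
  have G: "x \<in> S \<Longrightarrow> GDERIV f x :> G x" for x
    by (rule has_grad_lapD1[OF f])
  have f': "GDERIV (\<lambda>x. g' (f x)) x :> g'' (f x) *\<^sub>R G x" if "x \<in> S" for x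
    by (rule GDERIV_DERIV_compose[OF G g']) (use that in auto)
  have cont': "continuous_on S (\<lambda>x. g' (f x))"
    by (rule GDERIV_imp_continuous_on) (rule f')
  define HH where "HH e x = g' (f x) *\<^sub>R H e x + (G x \<bullet> e) *\<^sub>R (g'' (f x) *\<^sub>R G x)" for e x
  show ?thesis
    unfolding has_grad_lap_def
  proof (intro conjI ballI exI[of _ HH])
    fix x assume x: "x \<in> S"
    show "GDERIV (\<lambda>x. g (f x)) x :> g' (f x) *\<^sub>R G x"
      by (rule GDERIV_DERIV_compose[OF G g]) (use x in auto)
    have "(\<Sum>e\<in>Basis. HH e x \<bullet> e) = g' (f x) * (\<Sum>e\<in>Basis. H e x \<bullet> e) +
        g'' (f x) * (\<Sum>e\<in>Basis. (G x \<bullet> e) * (G x \<bullet> e))"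
      by (simp add: HH_def inner_add_left sum.distrib sum_distrib_left algebra_simps)
    then show "g'' (f x) * (G x \<bullet> G x) + g' (f x) * L x = (\<Sum>e\<in>Basis. HH e x \<bullet> e)"
      using x by (simp add: H(3) euclidean_inner[of "G x" "G x"])
    fix e :: 'a assume e: "e \<in> Basis"
    show "GDERIV (\<lambda>y. g' (f y) *\<^sub>R G y \<bullet> e) x :> HH e x"
      using GDERIV_mult[OF f'[OF x] H(1)[OF e x]] by (simp add: HH_def)
  next
    fix e :: 'a assume e: "e \<in> Basis"
    show "continuous_on S (\<lambda>x. HH e x \<bullet> e)"
      unfolding HH_def inner_add_left inner_scaleR_left
      by (intro continuous_intros H(2) cont cont' has_grad_lap_continuous[OF f] e)
  qed
qed

lemma has_grad_lap_cmult:
  assumes "has_grad_lap S f G L"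
  shows "has_grad_lap S (\<lambda>x. c * f x) (\<lambda>x. c *\<^sub>R G x) (\<lambda>x. c * L x)"
  using has_grad_lap_compose[OF assms, of "\<lambda>x. c * x" "\<lambda>_. c" "\<lambda>_. 0"]
  by (auto intro!: derivative_eq_intros)

lemma has_grad_lap_diff:
  assumes "has_grad_lap S f G L" "has_grad_lap S f' G' L'"
  shows "has_grad_lap S (\<lambda>x. f x - f' x) (\<lambda>x. G x - G' x) (\<lambda>x. L x - L' x)"
  using has_grad_lap_add[OF assms(1) has_grad_lap_cmult[OF assms(2), of "-1"]] by simp

lemma has_grad_lap_zero: "has_grad_lap S (\<lambda>_. 0) (\<lambda>_. 0) (\<lambda>_. 0)"
  unfolding has_grad_lap_def
  by (auto intro!: exI[of _ "\<lambda>_ _. 0"] GDERIV_const simp del: gderiv_deriv)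

lemma has_grad_lap_sum:
  assumes "finite I" "\<And>i. i \<in> I \<Longrightarrow> has_grad_lap S (f i) (G i) (L i)"
  shows "has_grad_lap S (\<lambda>x. \<Sum>i\<in>I. f i x) (\<lambda>x. \<Sum>i\<in>I. G i x) (\<lambda>x. \<Sum>i\<in>I. L i x)"
  using assms by (induction I rule: finite_induct) (auto intro: has_grad_lap_zero has_grad_lap_add)

text \<open>The divergence theorem for the field a \<nabla>f, one coordinate at a time. The
  component \<open>h e\<close> is cut off by \<open>K\<close> because nothing is known outside
  \<open>S\<close>; it stays differentiable at the edge of \<open>K\<close> since it agrees with
  \<open>a x * (G x \<bullet> e)\<close> on all of the open set \<open>S\<close>. Only the
  derivative of \<open>h e\<close> in the direction \<open>e\<close> has to be bounded, which
  explains why continuity of the pure second derivatives is enough.\<close>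

lemma integration_by_parts:
  fixes S :: "'a::euclidean_space set"
  assumes "open S" "compact K" "K \<subseteq> S"
    and f: "has_grad_lap S f G L"
    and a: "\<And>x. x \<in> S \<Longrightarrow> GDERIV a x :> A x" and A: "continuous_on S A"
    and zero: "\<And>x. x \<in> S \<Longrightarrow> x \<notin> K \<Longrightarrow> a x = 0"
  shows "set_integrable lborel K (\<lambda>x. A x \<bullet> G x + a x * L x)"
    "(LINT x:K|lborel. A x \<bullet> G x + a x * L x) = 0"
proof -
  obtain H where H: "\<And>e x. e \<in> Basis \<Longrightarrow> x \<in> S \<Longrightarrow> GDERIV (\<lambda>y. G y \<bullet> e) x :> H e x"
    "\<And>e. e \<in> Basis \<Longrightarrow> continuous_on S (\<lambda>x. H e x \<bullet> e)"
    "\<And>x. x \<in> S \<Longrightarrow> L x = (\<Sum>e\<in>Basis. H e x \<bullet> e)"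
    using has_grad_lapE[OF f] by blast
  have "closed K" using \<open>compact K\<close> by (rule compact_imp_closed)
  define h where "h e x = (if x \<in> K then a x * (G x \<bullet> e) else 0)" for e x
  define D where "D e x = (if x \<in> K then a x *\<^sub>R H e x + (G x \<bullet> e) *\<^sub>R A x else 0)" for e x
  have der: "GDERIV (h e) x :> D e x" if e: "e \<in> Basis" for e x
  proof (cases "x \<in> K")
    case True
    then have "x \<in> S" using \<open>K \<subseteq> S\<close> by auto
    have "GDERIV (\<lambda>x. a x * (G x \<bullet> e)) x :> D e x"
      using GDERIV_mult[OF a[OF \<open>x \<in> S\<close>] H(1)[OF e \<open>x \<in> S\<close>]] True by (simp add: D_def)
    then show ?thesis
      by (rule GDERIV_cong[OF _ \<open>open S\<close> \<open>x \<in> S\<close>]) (auto simp: h_def zero)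
  next
    case False
    then have "GDERIV (h e) x :> 0"
      using GDERIV_zero_outside_support[OF \<open>closed K\<close>] by (auto simp: h_def simp del: gderiv_deriv)
    then show ?thesis
      using False by (simp add: D_def)
  qed
  have "continuous_on S (\<lambda>x. a x * (H e x \<bullet> e) + (G x \<bullet> e) * (A x \<bullet> e))" if "e \<in> Basis" for e
    using GDERIV_imp_continuous_on[OF a] that
    by (intro continuous_intros H(2) A has_grad_lap_continuous[OF f]) auto
  then have cont: "continuous_on K (\<lambda>x. a x * (H e x \<bullet> e) + (G x \<bullet> e) * (A x \<bullet> e))" if "e \<in> Basis" for e
    using that continuous_on_subset \<open>K \<subseteq> S\<close> by blast
  have bdd: "\<exists>B. \<forall>x. \<bar>D e x \<bullet> e\<bar> \<le> B" if e: "e \<in> Basis" for e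
  proof -
    obtain B where "0 < B" "\<And>x. x \<in> K \<Longrightarrow> norm (a x * (H e x \<bullet> e) + (G x \<bullet> e) * (A x \<bullet> e)) \<le> B"
      using compact_imp_bounded[OF compact_continuous_image[OF cont[OF e] \<open>compact K\<close>]]
      unfolding bounded_pos by auto
    then have "\<bar>D e x \<bullet> e\<bar> \<le> B" for x
      by (cases "x \<in> K") (auto simp: D_def inner_add_left)
    then show ?thesis by blast
  qed
  have int: "integrable lborel (\<lambda>x. D e x \<bullet> e)" "integral\<^sup>L lborel (\<lambda>x. D e x \<bullet> e) = 0"
    if e: "e \<in> Basis" for e
    using bdd[OF e] integral_directional_derivative_eq_0[OF \<open>compact K\<close> _ der[OF e], of e]
    by (auto simp: h_def)
  have eq: "(\<Sum>e\<in>Basis. D e x \<bullet> e) = indicator K x *\<^sub>R (A x \<bullet> G x + a x * L x)" for x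
  proof (cases "x \<in> K")
    case True
    then have "x \<in> S" using \<open>K \<subseteq> S\<close> by auto
    have "(\<Sum>e\<in>Basis. D e x \<bullet> e) = a x * (\<Sum>e\<in>Basis. H e x \<bullet> e) + (\<Sum>e\<in>Basis. (A x \<bullet> e) * (G x \<bullet> e))"
      using True by (simp add: D_def inner_add_left sum.distrib sum_distrib_left algebra_simps)
    then show ?thesis
      using True \<open>x \<in> S\<close> by (simp add: H(3) euclidean_inner[of "A x" "G x"])
  qed (simp add: D_def)
  have "integrable lborel (\<lambda>x. \<Sum>e\<in>Basis. D e x \<bullet> e)"
    by (intro Bochner_Integration.integrable_sum int)
  then show "set_integrable lborel K (\<lambda>x. A x \<bullet> G x + a x * L x)"
    by (simp add: eq set_integrable_def)
  have "integral\<^sup>L lborel (\<lambda>x. \<Sum>e\<in>Basis. D e x \<bullet> e) = 0"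
    by (subst Bochner_Integration.integral_sum) (simp_all add: int)
  then show "(LINT x:K|lborel. A x \<bullet> G x + a x * L x) = 0"
    by (simp add: eq set_lebesgue_integral_def)
qed

subsection \<open>The minimum principle\<close>

text \<open>Each pure second derivative is nonnegative. If one were negative, the first derivative
  along that line, being 0 at the minimum, would be negative just to the right, and the mean value
  theorem would yield a smaller value of \<open>f\<close>.\<close>

lemma laplacian_nonneg_at_min:
  fixes S :: "'a::euclidean_space set"
  assumes "open S" "x \<in> S" and f: "has_grad_lap S f G L"
    and min: "\<And>y. y \<in> S \<Longrightarrow> f x \<le> f y"
  shows "0 \<le> L x"
proof -
  obtain H where H: "\<And>e x. e \<in> Basis \<Longrightarrow> x \<in> S \<Longrightarrow> GDERIV (\<lambda>y. G y \<bullet> e) x :> H e x"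
    "\<And>x. x \<in> S \<Longrightarrow> L x = (\<Sum>e\<in>Basis. H e x \<bullet> e)"
    by (rule has_grad_lapE[OF f]) (rule that)
  obtain r where r: "0 < r" "ball x r \<subseteq> S"
    using \<open>open S\<close> \<open>x \<in> S\<close> by (rule openE)
  have "0 \<le> H e x \<bullet> e" if e: "e \<in> Basis" for e
  proof (rule ccontr)
    assume neg: "\<not> 0 \<le> H e x \<bullet> e"
    have inS: "x + t *\<^sub>R e \<in> S" if "\<bar>t\<bar> < r" for t
    proof -
      have "x + t *\<^sub>R e \<in> ball x r"
        using that e by (simp add: dist_norm)
      then show ?thesis using r by blast
    qed
    have d1: "((\<lambda>t. f (x + t *\<^sub>R e)) has_real_derivative G (x + t *\<^sub>R e) \<bullet> e) (at t)" if "\<bar>t\<bar> < r" for t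
      by (rule GDERIV_line[OF has_grad_lapD1[OF f inS[OF that]]])
    have d2: "((\<lambda>t. G (x + t *\<^sub>R e) \<bullet> e) has_real_derivative H e x \<bullet> e) (at 0)"
      by (rule GDERIV_line[where f="\<lambda>y. G y \<bullet> e"]) (use H(1)[OF e \<open>x \<in> S\<close>] in simp)
    have "G (x + 0 *\<^sub>R e) \<bullet> e = 0"
    proof (rule DERIV_local_min[OF d1 r(1)])
      show "\<forall>t. \<bar>0 - t\<bar> < r \<longrightarrow> f (x + 0 *\<^sub>R e) \<le> f (x + t *\<^sub>R e)"
        using min[OF inS] by simp
    qed (use r in simp)
    moreover obtain d where "0 < d"
      and d: "\<And>h. 0 < h \<Longrightarrow> h < d \<Longrightarrow> G (x + 0 *\<^sub>R e) \<bullet> e > G (x + (0 + h) *\<^sub>R e) \<bullet> e"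
      using DERIV_neg_dec_right[OF d2] neg by (meson not_le)
    ultimately have G_neg: "0 < h \<Longrightarrow> h < d \<Longrightarrow> G (x + h *\<^sub>R e) \<bullet> e < 0" for h
      by simp
    define s where "s = min d r / 2"
    have s: "0 < s" "s < d" "s < r"
      using \<open>0 < d\<close> r(1) by (auto simp: s_def)
    obtain z where z: "0 < z" "z < s"
      "f (x + s *\<^sub>R e) - f (x + 0 *\<^sub>R e) = (s - 0) * (G (x + z *\<^sub>R e) \<bullet> e)"
    proof -
      have "\<exists>z>0. z < s \<and> f (x + s *\<^sub>R e) - f (x + 0 *\<^sub>R e) = (s - 0) * (G (x + z *\<^sub>R e) \<bullet> e)"
        by (rule MVT2[of 0 s "\<lambda>t. f (x + t *\<^sub>R e)" "\<lambda>t. G (x + t *\<^sub>R e) \<bullet> e"])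
           (use s in \<open>auto intro!: d1 simp del: gderiv_deriv\<close>)
      then show thesis using that by blast
    qed
    then have "f (x + s *\<^sub>R e) < f x"
      using G_neg[of z] s mult_pos_neg[of s "G (x + z *\<^sub>R e) \<bullet> e"] by simp
    then show False
      using min[OF inS[of s]] s by simp
  qed
  then show ?thesis
    by (simp add: H(2)[OF \<open>x \<in> S\<close>] sum_nonneg)
qed

lemma attains_min_inside:
  fixes w :: "'a::euclidean_space \<Rightarrow> real"
  assumes "bounded S" "open S" "continuous_on UNIV w" "\<And>x. x \<notin> S \<Longrightarrow> w x = 0" "x \<in> S" "w x < 0"
  obtains z where "z \<in> S" "w z < 0" "\<And>y. y \<in> S \<Longrightarrow> w z \<le> w y"
proof -
  have "compact (closure S)" "closure S \<noteq> {}"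
    using assms by auto
  then obtain z where z: "z \<in> closure S" "\<And>y. y \<in> closure S \<Longrightarrow> w z \<le> w y"
    using continuous_attains_inf[of "closure S" w] assms(3) continuous_on_subset by blast
  have "w z \<le> w x"
    using z(2) \<open>x \<in> S\<close> closure_subset by blast
  then have "w z < 0"
    using assms(6) by simp
  with assms(4) have "z \<in> S" by fastforce
  show ?thesis
    by (rule that[OF \<open>z \<in> S\<close> \<open>w z < 0\<close>]) (use z(2) closure_subset in blast)
qed

text \<open>A negative minimum would lie inside \<open>S\<close>, where the Laplacian cannot be
  negative. Asking for the sign of \<open>L\<close> only where \<open>w x < 0\<close> lets nonlinear
  comparison arguments use the inequality \<open>w x < 0\<close> itself to establish that
  sign.\<close>

lemma min_principle:
  fixes w :: "'a::euclidean_space \<Rightarrow> real"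
  assumes S: "bounded S" "open S" and w: "continuous_on UNIV w" "\<And>x. x \<notin> S \<Longrightarrow> w x = 0"
    and f: "has_grad_lap S w G L" and L: "\<And>x. x \<in> S \<Longrightarrow> w x < 0 \<Longrightarrow> L x < 0"
  shows "0 \<le> w x"
proof (rule ccontr)
  assume neg: "\<not> 0 \<le> w x"
  then have "x \<in> S" using w(2) by force
  obtain z where z: "z \<in> S" "w z < 0" "\<And>y. y \<in> S \<Longrightarrow> w z \<le> w y"
    using attains_min_inside[OF S w \<open>x \<in> S\<close>] neg by (metis not_le)
  show False
    using laplacian_nonneg_at_min[OF S(2) z(1) f z(3)] L[OF z(1,2)] by simp
qed

text \<open>With a strictly negative Laplacian an interior zero of the nonnegative \<open>w\<close>
  is already contradictory, being a minimum; this stands in for Hopf's argument.\<close>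

lemma strong_min_principle:
  fixes w :: "'a::euclidean_space \<Rightarrow> real"
  assumes S: "bounded S" "open S" and w: "continuous_on UNIV w" "\<And>x. x \<notin> S \<Longrightarrow> w x = 0"
    and f: "has_grad_lap S w G L" and L: "\<And>x. x \<in> S \<Longrightarrow> L x < 0" and "x \<in> S"
  shows "0 < w x"
proof (rule ccontr)
  have nonneg: "0 \<le> w y" for y
    using min_principle[OF S w f] L by blast
  assume "\<not> 0 < w x"
  with nonneg[of x] have "w x \<le> w y" for y
    using nonneg[of y] by simp
  then show False
    using laplacian_nonneg_at_min[OF S(2) \<open>x \<in> S\<close> f] L[OF \<open>x \<in> S\<close>] by fastforce
qed

subsection \<open>From smooth solutions to a system on the whole space\<close>

lemma iterated_partial_partial_deriv:
  "iterated_partial es (partial_deriv e f) = iterated_partial (es @ [e]) f"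
  by (simp add: iterated_partial_def)

lemma smooth_on_partial_deriv:
  assumes "smooth_on S f" "e \<in> Basis"
  shows "smooth_on S (partial_deriv e f)"
  using assms by (auto simp: smooth_on_def iterated_partial_partial_deriv)

lemma smooth_on_imp_GDERIV:
  assumes "open S" "smooth_on S f" "x \<in> S"
  shows "GDERIV f x :> (\<Sum>e\<in>Basis. partial_deriv e f x *\<^sub>R e)"
proof -
  have "iterated_partial [] f differentiable_on S"
    using assms(2) unfolding smooth_on_def by blast
  then have "f differentiable (at x)"
    using assms differentiable_on_eq_differentiable_at by (auto simp: iterated_partial_def)
  then have der: "(f has_derivative frechet_derivative f (at x)) (at x)"
    by (simp add: frechet_derivative_works)
  interpret bounded_linear "frechet_derivative f (at x)"
    using der by (rule has_derivative_bounded_linear)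
  have "frechet_derivative f (at x) h = h \<bullet> (\<Sum>e\<in>Basis. partial_deriv e f x *\<^sub>R e)" for h
  proof -
    have "frechet_derivative f (at x) h = frechet_derivative f (at x) (\<Sum>e\<in>Basis. (h \<bullet> e) *\<^sub>R e)"
      by (simp add: euclidean_representation)
    also have "\<dots> = (\<Sum>e\<in>Basis. (h \<bullet> e) * partial_deriv e f x)"
      by (simp add: sum scaleR partial_deriv_def)
    finally show ?thesis
      by (simp add: inner_sum_right mult.commute)
  qed
  then have "frechet_derivative f (at x) = (\<lambda>h. h \<bullet> (\<Sum>e\<in>Basis. partial_deriv e f x *\<^sub>R e))" ..
  with der show ?thesis
    unfolding gderiv_def by simp
qed

lemma smooth_on_imp_has_grad_lap:
  fixes S :: "'a::euclidean_space set"
  assumes "open S" "smooth_on S f"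
  shows "has_grad_lap S f (\<lambda>x. \<Sum>e\<in>Basis. partial_deriv e f x *\<^sub>R e) (laplacian f)"
proof -
  have comp: "(\<Sum>b\<in>Basis. g b *\<^sub>R b) \<bullet> e = g e" if "e \<in> Basis" for e :: 'a and g
    using that by simp
  have cont: "continuous_on S g" if "smooth_on S g" for g
    by (rule GDERIV_imp_continuous_on) (rule smooth_on_imp_GDERIV[OF \<open>open S\<close> that])
  show ?thesis
    unfolding has_grad_lap_def laplacian_def
  proof (intro conjI ballI exI[of _ "\<lambda>e x. \<Sum>b\<in>Basis. partial_deriv b (partial_deriv e f) x *\<^sub>R b"])
    fix x assume "x \<in> S"
    then show "GDERIV f x :> (\<Sum>e\<in>Basis. partial_deriv e f x *\<^sub>R e)"
      by (rule smooth_on_imp_GDERIV[OF assms])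
    show "(\<Sum>e\<in>Basis. partial_deriv e (partial_deriv e f) x) =
        (\<Sum>e\<in>Basis. (\<Sum>b\<in>Basis. partial_deriv b (partial_deriv e f) x *\<^sub>R b) \<bullet> e)"
      by (intro sum.cong refl) (simp add: comp)
    fix e :: 'a assume e: "e \<in> Basis"
    show "GDERIV (\<lambda>y. (\<Sum>e\<in>Basis. partial_deriv e f y *\<^sub>R e) \<bullet> e) x :>
        (\<Sum>b\<in>Basis. partial_deriv b (partial_deriv e f) x *\<^sub>R b)"
      unfolding comp[OF e]
      by (rule smooth_on_imp_GDERIV[OF \<open>open S\<close> smooth_on_partial_deriv[OF assms(2) e] \<open>x \<in> S\<close>])
  next
    fix e :: 'a assume e: "e \<in> Basis"
    show "continuous_on S (\<lambda>x. (\<Sum>b\<in>Basis. partial_deriv b (partial_deriv e f) x *\<^sub>R b) \<bullet> e)"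
      unfolding comp[OF e]
      by (intro cont smooth_on_partial_deriv assms e)
  qed
qed

lemma GDERIV_imp_partial_deriv:
  assumes "GDERIV f x :> D"
  shows "partial_deriv e f x = D \<bullet> e"
  using frechet_derivative_at[OF assms[unfolded gderiv_def]]
  unfolding partial_deriv_def by (metis inner_commute)

lemma has_grad_lap_imp_laplacian:
  fixes S :: "'a::euclidean_space set"
  assumes "open S" and f: "has_grad_lap S f G L" and "x \<in> S"
  shows "laplacian f x = L x"
proof -
  obtain H where H: "\<And>e x. e \<in> Basis \<Longrightarrow> x \<in> S \<Longrightarrow> GDERIV (\<lambda>y. G y \<bullet> e) x :> H e x"
    "\<And>x. x \<in> S \<Longrightarrow> L x = (\<Sum>e\<in>Basis. H e x \<bullet> e)"
    by (rule has_grad_lapE[OF f]) (rule that)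
  have "partial_deriv e (partial_deriv e f) x = H e x \<bullet> e" if e: "e \<in> Basis" for e
  proof (rule GDERIV_imp_partial_deriv)
    show "GDERIV (partial_deriv e f) x :> H e x"
      using GDERIV_imp_partial_deriv[OF has_grad_lapD1[OF f]]
      by (intro GDERIV_cong[OF H(1)[OF e \<open>x \<in> S\<close>] \<open>open S\<close> \<open>x \<in> S\<close>]) simp
  qed
  then show ?thesis
    by (simp add: laplacian_def H(2)[OF \<open>x \<in> S\<close>])
qed

text \<open>Meant for \<open>laplacian u\<close>, whose values off the open domain carry no
  information: on the frontier only its limit from inside is known.\<close>

lemma continuous_zero_extension:
  fixes f :: "'a::t2_space \<Rightarrow> real"
  assumes "open S" and cont: "continuous_on S f"
    and lim: "\<And>x. x \<in> frontier S \<Longrightarrow> (f \<longlongrightarrow> 0) (at x within S)"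
  shows "continuous_on UNIV (\<lambda>x. if x \<in> S then f x else 0)"
proof -
  let ?F = "\<lambda>x. if x \<in> S then f x else 0"
  have "isCont ?F x" for x
  proof -
    consider "x \<in> S" | "x \<in> frontier S" | "x \<in> - closure S"
      using \<open>open S\<close> by (auto simp: frontier_def interior_open)
    then show ?thesis
    proof cases
      case 1
      then have "isCont f x"
        using cont \<open>open S\<close> continuous_on_eq_continuous_at by blast
      then show ?thesis
        using 1 \<open>open S\<close> eventually_nhds_in_open[of S x]
        by (subst isCont_cong[of _ f]) (auto elim: eventually_mono)
    next
      case 2
      then have "x \<notin> S"
        using \<open>open S\<close> by (auto simp: frontier_def interior_open)
      have "(?F \<longlongrightarrow> 0) (at x within S)"
        using lim[OF 2] by (rule Lim_transform_eventually) (simp add: eventually_at_filter)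
      moreover have "(?F \<longlongrightarrow> 0) (at x within - S)"
        using tendsto_const[of 0] by (rule Lim_transform_eventually) (simp add: eventually_at_filter)
      ultimately have "(?F \<longlongrightarrow> 0) (at x within S \<union> - S)"
        by (rule Lim_Un)
      then show ?thesis
        using \<open>x \<notin> S\<close> by (simp add: isCont_def)
    next
      case 3
      have "eventually (\<lambda>y. y \<in> - closure S) (nhds x)"
        using 3 by (intro eventually_nhds_in_open) auto
      then have "eventually (\<lambda>y. ?F y = 0) (nhds x)"
        by eventually_elim (use closure_subset in auto)
      then show ?thesis
        by (subst isCont_cong[of _ "\<lambda>_. 0"]) auto
    qed
  qed
  then show ?thesis
    by (simp add: continuous_on_eq_continuous_at)
qed

text \<open>\<open>U\<close> and \<open>V\<close> stand for a solution \<open>u\<close> and for \<open>-\<Delta>u\<close>, both extended by \<open>0\<close>.\<close>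

definition gelfand_system ::
    "'a::euclidean_space set \<Rightarrow> real \<Rightarrow> ('a \<Rightarrow> real) \<Rightarrow> ('a \<Rightarrow> real) \<Rightarrow> bool" where
  "gelfand_system \<Omega> l U V \<longleftrightarrow>
     continuous_on UNIV U \<and> continuous_on UNIV V \<and> (\<forall>x. x \<notin> \<Omega> \<longrightarrow> U x = 0 \<and> V x = 0) \<and>
     (\<exists>G. has_grad_lap \<Omega> U G (\<lambda>x. - V x)) \<and>
     (\<exists>G. has_grad_lap \<Omega> V G (\<lambda>x. - (l * exp (U x))))"

lemma gelfand_systemD:
  assumes "gelfand_system \<Omega> l U V"
  shows "continuous_on UNIV U" "continuous_on UNIV V"
    "x \<notin> \<Omega> \<Longrightarrow> U x = 0" "x \<notin> \<Omega> \<Longrightarrow> V x = 0"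
    "\<exists>G. has_grad_lap \<Omega> U G (\<lambda>x. - V x)"
    "\<exists>G. has_grad_lap \<Omega> V G (\<lambda>x. - (l * exp (U x)))"
  using assms by (auto simp: gelfand_system_def)

lemma navier_solution_imp_gelfand_system:
  fixes \<Omega> :: "'a::euclidean_space set"
  assumes "open \<Omega>" and u: "navier_solution exp \<Omega> l u"
  obtains U V where "gelfand_system \<Omega> l U V" "\<And>x. x \<in> \<Omega> \<Longrightarrow> U x = u x"
proof -
  have sm: "smooth_on \<Omega> u" and cl: "continuous_on (closure \<Omega>) u"
    and eq: "\<And>x. x \<in> \<Omega> \<Longrightarrow> laplacian (laplacian u) x = l * exp (u x)"
    and bd: "\<And>x. x \<in> frontier \<Omega> \<Longrightarrow> u x = 0"
      "\<And>x. x \<in> frontier \<Omega> \<Longrightarrow> (laplacian u \<longlongrightarrow> 0) (at x within \<Omega>)"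
    using u by (auto simp: navier_solution_def smooth_on_closure_def)
  define U where "U x = (if x \<in> \<Omega> then u x else 0)" for x
  define V where "V x = (if x \<in> \<Omega> then - laplacian u x else 0)" for x
  obtain G where G: "has_grad_lap \<Omega> u G (laplacian u)"
    using smooth_on_imp_has_grad_lap[OF \<open>open \<Omega>\<close> sm] by blast
  \<comment> \<open>\<open>laplacian u\<close> is a finite sum of second partials, each smooth in
    its own right, so the regularity is inherited termwise. The sum \<open>L'\<close> produced here
    is recognised afterwards as the bi-Laplacian by
    \<open>has_grad_lap_imp_laplacian\<close>.\<close>
  obtain G' L' where G': "has_grad_lap \<Omega> (laplacian u) G' L'"
  proof -
    have "has_grad_lap \<Omega> (partial_deriv e (partial_deriv e u))
        (\<lambda>x. \<Sum>b\<in>Basis. partial_deriv b (partial_deriv e (partial_deriv e u)) x *\<^sub>R b)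
        (laplacian (partial_deriv e (partial_deriv e u)))" if "e \<in> Basis" for e
      by (intro smooth_on_imp_has_grad_lap \<open>open \<Omega>\<close> smooth_on_partial_deriv sm that)
    from has_grad_lap_sum[OF finite_Basis this] show ?thesis
      by (intro that) (simp add: laplacian_def[abs_def])
  qed
  have "(u \<longlongrightarrow> 0) (at x within \<Omega>)" if "x \<in> frontier \<Omega>" for x
  proof -
    have "x \<in> closure \<Omega>" using that by (simp add: frontier_def)
    then have "(u \<longlongrightarrow> u x) (at x within closure \<Omega>)"
      using cl by (simp add: continuous_on_def)
    then show ?thesis
      using bd(1)[OF that] tendsto_within_subset[OF _ closure_subset] by metis
  qed
  then have U: "continuous_on UNIV U"
    unfolding U_def using continuous_zero_extension[OF \<open>open \<Omega>\<close> has_grad_lap_continuous(1)[OF G]] by blast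
  have V: "continuous_on UNIV V"
    unfolding V_def
    using has_grad_lap_continuous(1)[OF G'] tendsto_minus[OF bd(2)]
    by (intro continuous_zero_extension \<open>open \<Omega>\<close> continuous_intros) auto
  have "has_grad_lap \<Omega> U G (\<lambda>x. - V x)"
    by (rule has_grad_lap_cong[OF G \<open>open \<Omega>\<close>]) (auto simp: U_def V_def)
  moreover have "has_grad_lap \<Omega> V (\<lambda>x. -1 *\<^sub>R G' x) (\<lambda>x. - (l * exp (U x)))"
    using has_grad_lap_imp_laplacian[OF \<open>open \<Omega>\<close> G'] eq
    by (intro has_grad_lap_cong[OF has_grad_lap_cmult[OF G', of "-1"] \<open>open \<Omega>\<close>]) (auto simp: U_def V_def)
  ultimately have "gelfand_system \<Omega> l U V"
    unfolding gelfand_system_def using U V by (auto simp: U_def V_def)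
  then show ?thesis
    by (rule that) (simp add: U_def)
qed

subsection \<open>Stability\<close>

lemma set_integrable_compact_continuous:
  fixes f :: "'a::euclidean_space \<Rightarrow> real"
  assumes "compact K" "continuous_on K f"
  shows "set_integrable lborel K f"
  using borel_integrable_compact[OF assms] by (simp add: set_integrable_def)

text \<open>Barta's trick: test the equation of the positive function \<open>\<phi>\<close> with \<open>\<eta>\<^sup>2 / \<phi>\<close>.\<close>

lemma barta_inequality:
  fixes S :: "'a::euclidean_space set"
  assumes S: "open S" "compact K" "K \<subseteq> S"
    and phi: "has_grad_lap S \<phi> G L" and pos: "\<And>x. x \<in> S \<Longrightarrow> 0 < \<phi> x"
    and eta: "\<And>x. x \<in> S \<Longrightarrow> GDERIV \<eta> x :> E x" and E: "continuous_on S E"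
    and zero: "\<And>x. x \<in> S \<Longrightarrow> x \<notin> K \<Longrightarrow> \<eta> x = 0"
  shows "(LINT x:K|lborel. (\<eta> x)\<^sup>2 * (- L x) / \<phi> x) \<le> (LINT x:K|lborel. E x \<bullet> E x)"
proof -
  define a where "a x = \<eta> x * \<eta> x * inverse (\<phi> x)" for x
  define A where "A x = (\<eta> x * \<eta> x) *\<^sub>R (- (inverse (\<phi> x))\<^sup>2 *\<^sub>R G x) +
      inverse (\<phi> x) *\<^sub>R (\<eta> x *\<^sub>R E x + \<eta> x *\<^sub>R E x)" for x
  have nz: "\<phi> x \<noteq> 0" if "x \<in> S" for x
    using pos[OF that] by simp
  have a: "GDERIV a x :> A x" if "x \<in> S" for x
    unfolding a_def A_def
    by (rule GDERIV_mult[OF GDERIV_mult[OF eta[OF that] eta[OF that]]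
          GDERIV_inverse[OF has_grad_lapD1[OF phi that] nz[OF that]]])
  have cont: "continuous_on S \<phi>" "continuous_on S G" "continuous_on S L" "continuous_on S \<eta>"
    using has_grad_lap_continuous[OF phi] GDERIV_imp_continuous_on[OF eta] by auto
  have contA: "continuous_on S A"
    unfolding A_def using nz by (intro continuous_intros cont E) auto
  have "a x = 0" if "x \<in> S" "x \<notin> K" for x
    using zero that by (simp add: a_def)
  note ibp = integration_by_parts[OF S phi a contA this]
  have int: "set_integrable lborel K (\<lambda>x. (\<eta> x)\<^sup>2 * (- L x) / \<phi> x)"
      "set_integrable lborel K (\<lambda>x. E x \<bullet> E x)"
    using nz \<open>K \<subseteq> S\<close>
    by (auto intro!: set_integrable_compact_continuous[OF \<open>compact K\<close>] continuous_intros
        continuous_on_subset[OF cont(1)] continuous_on_subset[OF cont(3)]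
        continuous_on_subset[OF cont(4)] continuous_on_subset[OF E])
  have "(LINT x:K|lborel. (\<eta> x)\<^sup>2 * (- L x) / \<phi> x) =
      (LINT x:K|lborel. (\<eta> x)\<^sup>2 * (- L x) / \<phi> x) + (LINT x:K|lborel. A x \<bullet> G x + a x * L x)"
    using ibp(2) by simp
  also have "\<dots> = (LINT x:K|lborel. (\<eta> x)\<^sup>2 * (- L x) / \<phi> x + (A x \<bullet> G x + a x * L x))"
    by (rule set_integral_add(2)[symmetric, OF int(1) ibp(1)])
  also have "\<dots> \<le> (LINT x:K|lborel. E x \<bullet> E x)"
  proof (rule set_integral_mono[OF set_integral_add(1)[OF int(1) ibp(1)] int(2)])
    fix x assume "x \<in> K"
    \<comment> \<open>The cross term is completed to a square: the integrand equals |E|^2 - |E - p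
      G|^2.\<close>
    define p where "p = \<eta> x / \<phi> x"
    have "(\<eta> x)\<^sup>2 * (- L x) / \<phi> x + (A x \<bullet> G x + a x * L x) = 2 * p * (E x \<bullet> G x) - p\<^sup>2 * (G x \<bullet> G x)"
      by (simp add: A_def a_def p_def inner_add_left power2_eq_square divide_inverse algebra_simps)
    also have "\<dots> = E x \<bullet> E x - (E x - p *\<^sub>R G x) \<bullet> (E x - p *\<^sub>R G x)"
      by (simp add: inner_diff_left inner_diff_right inner_commute power2_eq_square algebra_simps)
    also have "\<dots> \<le> E x \<bullet> E x"
      by simp
    finally show "(\<eta> x)\<^sup>2 * (- L x) / \<phi> x + (A x \<bullet> G x + a x * L x) \<le> E x \<bullet> E x" .
  qed
  finally show ?thesis .
qed

text \<open>Average Barta's inequality for \<open>\<phi>\<close> and for \<open>\<psi>\<close>; by AM-GM, \<open>\<psi> / \<phi> + \<rho>\<^sup>2 \<phi> / \<psi> \<ge> 2 \<rho>\<close>.\<close>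

lemma stability_of_system:
  fixes S :: "'a::euclidean_space set"
  assumes S: "open S" "compact K" "K \<subseteq> S"
    and phi: "has_grad_lap S \<phi> G (\<lambda>x. - \<psi> x)" "\<And>x. x \<in> S \<Longrightarrow> 0 < \<phi> x"
    and psi: "has_grad_lap S \<psi> G' L" "\<And>x. x \<in> S \<Longrightarrow> 0 < \<psi> x"
    and rho: "continuous_on S \<rho>" "\<And>x. x \<in> S \<Longrightarrow> (\<rho> x)\<^sup>2 * \<phi> x \<le> - L x"
    and eta: "\<And>x. x \<in> S \<Longrightarrow> GDERIV \<eta> x :> E x" "continuous_on S E"
      "\<And>x. x \<in> S \<Longrightarrow> x \<notin> K \<Longrightarrow> \<eta> x = 0"
  shows "(LINT x:K|lborel. \<rho> x * (\<eta> x)\<^sup>2) \<le> (LINT x:K|lborel. E x \<bullet> E x)"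
proof -
  have cont: "continuous_on K \<phi>" "continuous_on K \<psi>" "continuous_on K L" "continuous_on K \<eta>" "continuous_on K \<rho>"
    using has_grad_lap_continuous[OF phi(1)] has_grad_lap_continuous[OF psi(1)]
      GDERIV_imp_continuous_on[OF eta(1)] rho(1) continuous_on_subset[OF _ \<open>K \<subseteq> S\<close>] by auto
  have nz: "\<phi> x \<noteq> 0" "\<psi> x \<noteq> 0" if "x \<in> K" for x
    using phi(2)[of x] psi(2)[of x] that \<open>K \<subseteq> S\<close> by auto
  have int: "set_integrable lborel K (\<lambda>x. (\<eta> x)\<^sup>2 * (- (- \<psi> x)) / \<phi> x)"
      "set_integrable lborel K (\<lambda>x. (\<eta> x)\<^sup>2 * (- L x) / \<psi> x)"
      "set_integrable lborel K (\<lambda>x. 2 * (\<rho> x * (\<eta> x)\<^sup>2))"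
    using nz by (auto intro!: set_integrable_compact_continuous[OF \<open>compact K\<close>] continuous_intros cont)
  have "2 * (LINT x:K|lborel. \<rho> x * (\<eta> x)\<^sup>2) = (LINT x:K|lborel. 2 * (\<rho> x * (\<eta> x)\<^sup>2))"
    by simp
  also have "\<dots> \<le> (LINT x:K|lborel. (\<eta> x)\<^sup>2 * (- (- \<psi> x)) / \<phi> x + (\<eta> x)\<^sup>2 * (- L x) / \<psi> x)"
  proof (rule set_integral_mono[OF int(3) set_integral_add(1)[OF int(1,2)]])
    fix x assume x: "x \<in> K"
    then have xS: "x \<in> S" using \<open>K \<subseteq> S\<close> by auto
    have p: "0 < \<phi> x" "0 < \<psi> x"
      using phi(2)[OF xS] psi(2)[OF xS] .
    have "0 \<le> (\<psi> x - \<rho> x * \<phi> x)\<^sup>2 / (\<phi> x * \<psi> x)"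
      using p by simp
    also have "\<dots> = \<psi> x / \<phi> x + (\<rho> x)\<^sup>2 * \<phi> x / \<psi> x - 2 * \<rho> x"
      using p by (simp add: field_simps power2_eq_square)
    also have "\<dots> \<le> \<psi> x / \<phi> x + (- L x) / \<psi> x - 2 * \<rho> x"
      using p rho(2)[OF xS] divide_right_mono[of "(\<rho> x)\<^sup>2 * \<phi> x" "- L x" "\<psi> x"] by simp
    finally have "(\<eta> x)\<^sup>2 * (2 * \<rho> x) \<le> (\<eta> x)\<^sup>2 * (\<psi> x / \<phi> x + (- L x) / \<psi> x)"
      by (intro mult_left_mono) auto
    then show "2 * (\<rho> x * (\<eta> x)\<^sup>2) \<le> (\<eta> x)\<^sup>2 * (- (- \<psi> x)) / \<phi> x + (\<eta> x)\<^sup>2 * (- L x) / \<psi> x"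
      by (simp add: algebra_simps)
  qed
  also have "\<dots> = (LINT x:K|lborel. (\<eta> x)\<^sup>2 * (- (- \<psi> x)) / \<phi> x) + (LINT x:K|lborel. (\<eta> x)\<^sup>2 * (- L x) / \<psi> x)"
    by (rule set_integral_add(2)[OF int(1,2)])
  also have "\<dots> \<le> (LINT x:K|lborel. E x \<bullet> E x) + (LINT x:K|lborel. E x \<bullet> E x)"
    by (intro add_mono barta_inequality[OF S phi eta] barta_inequality[OF S psi eta])
  finally show ?thesis by simp
qed

text \<open>Nonnegativity of the second order operator -\<Delta> - sqrt(\<lambda> exp u), used in
  place of the fourth order stability form. It admits test functions that are merely C^1, such as
  truncated powers of \<open>V\<close>. The compact set \<open>K\<close> is explicit so that both
  integrals are over continuous functions on a compact set.\<close>

definition stable_solution :: "'a::euclidean_space set \<Rightarrow> real \<Rightarrow> ('a \<Rightarrow> real) \<Rightarrow> bool" where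
  "stable_solution \<Omega> l U \<longleftrightarrow>
     (\<forall>K \<eta> E. compact K \<longrightarrow> K \<subseteq> \<Omega> \<longrightarrow> (\<forall>x\<in>\<Omega>. GDERIV \<eta> x :> E x) \<longrightarrow> continuous_on \<Omega> E \<longrightarrow>
       (\<forall>x\<in>\<Omega> - K. \<eta> x = 0) \<longrightarrow>
       (LINT x:K|lborel. sqrt l * exp (U x / 2) * (\<eta> x)\<^sup>2) \<le> (LINT x:K|lborel. E x \<bullet> E x))"

text \<open>The positive supersolution is the difference of two solutions of
  the branch, so no eigenfunction is needed.\<close>

lemma gelfand_stability:
  fixes \<Omega> :: "'a::euclidean_space set"
  assumes \<Omega>: "open \<Omega>" "bounded \<Omega>" and l: "0 < l" "l < m"
    and sys: "gelfand_system \<Omega> l U V" "gelfand_system \<Omega> m U' V'"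
    and less: "\<And>x. x \<in> \<Omega> \<Longrightarrow> U x < U' x"
  shows "stable_solution \<Omega> l U"
proof -
  obtain G1 G2 G3 G4 where G: "has_grad_lap \<Omega> U G1 (\<lambda>x. - V x)"
      "has_grad_lap \<Omega> V G2 (\<lambda>x. - (l * exp (U x)))"
      "has_grad_lap \<Omega> U' G3 (\<lambda>x. - V' x)"
      "has_grad_lap \<Omega> V' G4 (\<lambda>x. - (m * exp (U' x)))"
    using gelfand_systemD(5,6)[OF sys(1)] gelfand_systemD(5,6)[OF sys(2)] by blast
  have phi: "has_grad_lap \<Omega> (\<lambda>x. U' x - U x) (\<lambda>x. G3 x - G1 x) (\<lambda>x. - (V' x - V x))"
    using has_grad_lap_diff[OF G(3,1)] by (simp add: algebra_simps)
  have psi: "has_grad_lap \<Omega> (\<lambda>x. V' x - V x) (\<lambda>x. G4 x - G2 x) (\<lambda>x. l * exp (U x) - m * exp (U' x))"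
    using has_grad_lap_diff[OF G(4,2)] by (simp add: algebra_simps)
  \<comment> \<open>The tangent line of \<open>exp\<close> at \<open>U x\<close> lies below the
    graph; this gives the supersolution property. The inequality is strict because
    \<open>l < m\<close>, and the same two facts make the Laplacian of \<open>V' - V\<close>
    strictly negative, as the strong minimum principle demands.\<close>
  have super: "(sqrt l * exp (U x / 2))\<^sup>2 * (U' x - U x) < - (l * exp (U x) - m * exp (U' x))"
    if "x \<in> \<Omega>" for x
  proof -
    have "(sqrt l * exp (U x / 2))\<^sup>2 = l * exp (U x)"
      using l by (simp add: power_mult_distrib flip: exp_double)
    moreover have "l * exp (U x) * (1 + (U' x - U x)) \<le> l * exp (U x) * exp (U' x - U x)"
      using l by (intro mult_left_mono exp_ge_add_one_self) auto
    moreover have "l * exp (U x) * exp (U' x - U x) < m * exp (U' x)"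
      using l by (simp add: mult.assoc flip: exp_add)
    ultimately show ?thesis
      by (simp add: algebra_simps)
  qed
  have L: "l * exp (U x) - m * exp (U' x) < 0" if "x \<in> \<Omega>" for x
  proof -
    have "0 \<le> (sqrt l * exp (U x / 2))\<^sup>2 * (U' x - U x)"
      using less[OF that] by simp
    then show ?thesis using super[OF that] by simp
  qed
  have "0 < V' x - V x" if "x \<in> \<Omega>" for x
    using gelfand_systemD(2,4)[OF sys(1)] gelfand_systemD(2,4)[OF sys(2)]
    by (intro strong_min_principle[OF \<Omega>(2,1) _ _ psi L that] continuous_intros) auto
  moreover have "continuous_on \<Omega> (\<lambda>x. sqrt l * exp (U x / 2))"
    by (intro continuous_intros continuous_on_subset[OF gelfand_systemD(1)[OF sys(1)]]) auto
  ultimately show ?thesis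
    unfolding stable_solution_def using super less
    by (intro allI impI stability_of_system[OF \<Omega>(1) _ _ phi _ psi]) (auto intro: less_imp_le)
qed

subsection \<open>The energy estimate\<close>

lemma gelfand_laplacian_nonneg:
  fixes \<Omega> :: "'a::euclidean_space set"
  assumes \<Omega>: "open \<Omega>" "bounded \<Omega>" and l: "0 < l" and sys: "gelfand_system \<Omega> l U V"
  shows "0 \<le> V x"
proof -
  obtain G where G: "has_grad_lap \<Omega> V G (\<lambda>x. - (l * exp (U x)))"
    using gelfand_systemD(6)[OF sys] by blast
  show ?thesis
    by (rule min_principle[OF \<Omega>(2,1) gelfand_systemD(2,4)[OF sys] G]) (use l in auto)
qed

text \<open>Compare \<open>V\<close> with z = c (exp(U/2) - 1), which vanishes where
  \<open>U\<close> does. The gradient term in \<Delta>z has a favourable sign. Where V < z, also V <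
  c exp(U/2), so (c/2) exp(U/2) V < (c^2/2) exp U; the choice c^2 = 2l makes this bound equal to
  -\<Delta>V, whence \<Delta>(V - z) < 0 exactly on the set that \<open>min_principle\<close> looks
  at.\<close>

lemma gelfand_pointwise:
  fixes \<Omega> :: "'a::euclidean_space set"
  assumes \<Omega>: "open \<Omega>" "bounded \<Omega>" and l: "0 < l" and sys: "gelfand_system \<Omega> l U V"
  shows "sqrt (2 * l) * (exp (U x / 2) - 1) \<le> V x"
proof -
  define c where "c = sqrt (2 * l)"
  have c: "0 < c" "c * c = 2 * l" using l by (auto simp: c_def)
  obtain G G' where G: "has_grad_lap \<Omega> U G (\<lambda>x. - V x)" "has_grad_lap \<Omega> V G' (\<lambda>x. - (l * exp (U x)))"
    using gelfand_systemD(5,6)[OF sys] by blast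
  have contU: "continuous_on S U" for S
    using gelfand_systemD(1)[OF sys] by (rule continuous_on_subset) simp
  have z: "has_grad_lap \<Omega> (\<lambda>x. c * (exp (U x / 2) - 1)) (\<lambda>x. (c / 2 * exp (U x / 2)) *\<^sub>R G x)
      (\<lambda>x. c / 4 * exp (U x / 2) * (G x \<bullet> G x) + c / 2 * exp (U x / 2) * (- V x))"
    by (rule has_grad_lap_compose[OF G(1), where g="\<lambda>t. c * (exp (t / 2) - 1)" and
          g'="\<lambda>t. c / 2 * exp (t / 2)" and g''="\<lambda>t. c / 4 * exp (t / 2)"])
       (auto intro!: derivative_eq_intros continuous_intros contU)
  have "0 \<le> V x - c * (exp (U x / 2) - 1)"
  proof (rule min_principle[OF \<Omega>(2,1) _ _ has_grad_lap_diff[OF G(2) z]])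
    show "continuous_on UNIV (\<lambda>x. V x - c * (exp (U x / 2) - 1))"
      by (intro continuous_intros contU gelfand_systemD(2)[OF sys]) auto
    show "V x - c * (exp (U x / 2) - 1) = 0" if "x \<notin> \<Omega>" for x
      using gelfand_systemD(3,4)[OF sys that] by simp
    fix x assume "x \<in> \<Omega>" and neg: "V x - c * (exp (U x / 2) - 1) < 0"
    define t where "t = exp (U x / 2)"
    have t: "0 < t" "exp (U x) = t * t"
      by (auto simp: t_def simp flip: exp_add)
    have "c * (t * V x) < c * (t * (c * t))"
      using neg c t by (intro mult_strict_left_mono) (auto simp: t_def algebra_simps)
    then have "c / 2 * t * V x < l * (t * t)"
      using c(2) by (simp add: field_simps) (simp flip: mult.assoc)
    moreover have "0 \<le> c / 4 * t * (G x \<bullet> G x)"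
      using c t by simp
    ultimately show "- (l * exp (U x)) - (c / 4 * exp (U x / 2) * (G x \<bullet> G x) +
        c / 2 * exp (U x / 2) * (- V x)) < 0"
      unfolding t(2) unfolding t_def[symmetric] by simp
  qed
  then show ?thesis by (simp add: c_def)
qed

lemma compact_superlevel:
  fixes V :: "'a::euclidean_space \<Rightarrow> real"
  assumes "bounded \<Omega>" "continuous_on UNIV V" "\<And>x. x \<notin> \<Omega> \<Longrightarrow> V x = 0" "0 < c"
  shows "compact {x. c \<le> V x}" "{x. c \<le> V x} \<subseteq> \<Omega>"
proof -
  show sub: "{x. c \<le> V x} \<subseteq> \<Omega>"
    using assms(3,4) by fastforce
  have "closed {x. c \<le> V x}"
    using assms(2) by (intro closed_Collect_le continuous_intros)
  moreover have "bounded {x. c \<le> V x}"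
    using sub \<open>bounded \<Omega>\<close> by (rule bounded_subset[rotated])
  ultimately show "compact {x. c \<le> V x}"
    by (simp add: compact_eq_bounded_closed)
qed

lemma GDERIV_max_powr:
  assumes f: "GDERIV f x :> D" and "1 < r"
  shows "GDERIV (\<lambda>x. max 0 (f x - c) powr r) x :> (r * max 0 (f x - c) powr (r - 1)) *\<^sub>R D"
proof -
  have "((\<lambda>t. max 0 (t - c) powr r) has_real_derivative r * max 0 (f x - c) powr (r - 1) * 1) (at (f x))"
    by (rule DERIV_chain2[where f="\<lambda>t. max 0 t powr r" and g="\<lambda>t. t - c", OF DERIV_max_powr[OF \<open>1 < r\<close>]])
       (auto intro!: derivative_eq_intros)
  then show ?thesis
    using GDERIV_DERIV_compose[OF f] by simp
qed

text \<open>With \<open>\<alpha> = 21/10\<close>, combine stability for \<open>\<eta> = s\<^sup>\<alpha>\<close> with the equation of \<open>V\<close> tested with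
  \<open>s\<^bsup>2\<alpha> - 1\<^esup>\<close>; the constant \<open>441/320\<close> is \<open>\<alpha>\<^sup>2 / (2\<alpha> - 1)\<close>.\<close>

lemma gelfand_energy:
  fixes \<Omega> :: "'a::euclidean_space set"
  assumes \<Omega>: "open \<Omega>" "bounded \<Omega>" and l: "0 < l" and sys: "gelfand_system \<Omega> l U V"
    and stable: "stable_solution \<Omega> l U"
  defines "\<rho> \<equiv> \<lambda>x. sqrt l * exp (U x / 2)" and "s \<equiv> \<lambda>x. max 0 (V x - 1)" and "K \<equiv> {x. 1 \<le> V x}"
  shows "320 * (LINT x:K|lborel. \<rho> x * s x powr (21/5)) \<le>
    441 * (LINT x:K|lborel. (\<rho> x)\<^sup>2 * s x powr (16/5))"
proof -
  have contU: "continuous_on S U" and contV: "continuous_on S V" for S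
    using gelfand_systemD(1,2)[OF sys] by (auto intro: continuous_on_subset)
  have K: "compact K" "K \<subseteq> \<Omega>"
    unfolding K_def using compact_superlevel[OF \<Omega>(2) contV gelfand_systemD(4)[OF sys], of 1] by auto
  obtain G where G: "has_grad_lap \<Omega> V G (\<lambda>x. - (l * exp (U x)))"
    using gelfand_systemD(6)[OF sys] by blast
  have contG: "continuous_on \<Omega> G"
    by (rule has_grad_lap_continuous[OF G])
  have rho2: "(\<rho> x)\<^sup>2 = l * exp (U x)" for x
    using l by (simp add: \<rho>_def power_mult_distrib flip: exp_double)
  have zero: "s x = 0" if "x \<notin> K" for x
    using that by (auto simp: s_def K_def)
  have cs: "continuous_on S (\<lambda>x. s x powr r)" if "0 < r" for S r
    unfolding s_def using that by (intro continuous_max_powr continuous_intros contV)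
  \<comment> \<open>The gradient term common to stability and to the tested equation; it is
    eliminated at the end.\<close>
  define J where "J = (LINT x:K|lborel. s x powr (11/5) * (G x \<bullet> G x))"
  have int: "set_integrable lborel K (\<lambda>x. s x powr (11/5) * (G x \<bullet> G x))"
      "set_integrable lborel K (\<lambda>x. (\<rho> x)\<^sup>2 * s x powr (16/5))"
    unfolding rho2 using continuous_on_subset[OF contG K(2)]
    by (auto intro!: set_integrable_compact_continuous[OF K(1)] continuous_intros cs contU)
  define E where "E x = (21/10 * s x powr (11/10)) *\<^sub>R G x" for x
  have "(LINT x:K|lborel. \<rho> x * s x powr (21/5)) = (LINT x:K|lborel. sqrt l * exp (U x / 2) * (s x powr (21/10))\<^sup>2)"
    by (simp add: \<rho>_def power2_eq_square flip: powr_add)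
  also have "\<dots> \<le> (LINT x:K|lborel. E x \<bullet> E x)"
  proof (rule stable[unfolded stable_solution_def, rule_format, OF K])
    show "GDERIV (\<lambda>x. s x powr (21/10)) x :> E x" if "x \<in> \<Omega>" for x
      using GDERIV_max_powr[OF has_grad_lapD1[OF G that], of "21/10" 1] by (simp add: s_def E_def)
    show "continuous_on \<Omega> E"
      unfolding E_def by (intro continuous_intros cs contG) auto
  qed (simp add: zero)
  also have "\<dots> = (LINT x:K|lborel. 441/100 * (s x powr (11/5) * (G x \<bullet> G x)))"
  proof -
    have "s x powr (11/10) * s x powr (11/10) = s x powr (11/5)" for x
      by (simp flip: powr_add)
    then have "E x \<bullet> E x = 441/100 * (s x powr (11/5) * (G x \<bullet> G x))" for x
      by (simp add: E_def flip: mult.assoc)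
    then show ?thesis by (simp only:)
  qed
  also have "\<dots> = 441/100 * J"
    by (simp add: J_def)
  finally have 1: "(LINT x:K|lborel. \<rho> x * s x powr (21/5)) \<le> 441/100 * J" .
  define A where "A x = (16/5 * s x powr (11/5)) *\<^sub>R G x" for x
  have "(LINT x:K|lborel. A x \<bullet> G x + s x powr (16/5) * (- (l * exp (U x)))) = 0"
  proof (rule integration_by_parts(2)[OF \<Omega>(1) K G])
    show "GDERIV (\<lambda>x. s x powr (16/5)) x :> A x" if "x \<in> \<Omega>" for x
      using GDERIV_max_powr[OF has_grad_lapD1[OF G that], of "16/5" 1] by (simp add: s_def A_def)
    show "continuous_on \<Omega> A"
      unfolding A_def by (intro continuous_intros cs contG) auto
  qed (simp add: zero)
  also have "(LINT x:K|lborel. A x \<bullet> G x + s x powr (16/5) * (- (l * exp (U x)))) =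
      (LINT x:K|lborel. 16/5 * (s x powr (11/5) * (G x \<bullet> G x)) - (\<rho> x)\<^sup>2 * s x powr (16/5))"
    by (simp add: A_def rho2 mult_ac)
  also have "\<dots> = 16/5 * J - (LINT x:K|lborel. (\<rho> x)\<^sup>2 * s x powr (16/5))"
    unfolding J_def using int by (subst set_integral_diff) auto
  finally show ?thesis
    using 1 by simp
qed

text \<open>The right side of the energy inequality is absorbed pointwise: for large
  \<open>s\<close> it is at most 319/320 of the left integrand after scaling, for bounded
  \<open>s\<close> at most a constant. The margin 320 - 319 = 1 controls \<integral> rho
  s^(2\<alpha>), and a further pointwise comparison passes to the power 13/5 of the source. The
  parameter enters the constants only through its upper bound \<open>m\<close>.\<close>

lemma gelfand_source_bound:
  fixes \<Omega> :: "'a::euclidean_space set"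
  assumes \<Omega>: "open \<Omega>" "bounded \<Omega>" and "0 < m"
  obtains C where "\<And>l U V. 0 < l \<Longrightarrow> l \<le> m \<Longrightarrow> gelfand_system \<Omega> l U V \<Longrightarrow> stable_solution \<Omega> l U \<Longrightarrow>
    (\<integral>\<^sup>+x\<in>\<Omega>. ennreal ((l * exp (U x)) powr (13/5)) \<partial>lborel) \<le> ennreal C"
proof -
  \<comment> \<open>The slope in the bound of rho by \<open>V\<close>, estimated by a rational
    number just above it.\<close>
  define q :: real where "q = 1 / sqrt 2"
  have q: "0 < q" "q < 71/100"
  proof -
    have "(71/100 * sqrt 2)\<^sup>2 > (1::real)\<^sup>2"
      by (simp add: power_mult_distrib power2_eq_square)
    then have "71/100 * sqrt 2 > 1"
      by (rule power2_less_imp_less) simp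
    then show "0 < q" "q < 71/100" by (simp_all add: q_def field_simps)
  qed
  \<comment> \<open>On \<open>K\<close> one has \<open>V x = s x + 1\<close>, so q V + sqrt m = q s
    + c; off \<open>K\<close> the same \<open>c\<close> bounds rho because
    \<open>V x < 1\<close>.\<close>
  define c where "c = q + sqrt m"
  have c: "0 < c" using q \<open>0 < m\<close> by (simp add: c_def add_pos_pos)
  \<comment> \<open>Beyond \<open>S\<close> the constant \<open>c\<close> is at most s/100, and 441
    (71/100 + 1/100) = 317.52 is still below 319.\<close>
  define S where "S = 100 * c"
  define C1 where "C1 = 441 * (S powr (16/5) * (S + c)\<^sup>2)"
  define W where "W = measure lborel \<Omega>"
  define C where "C = 2 powr (21/5) * (C1 * W) + (3 * c) powr (26/5) * W"
  have "0 \<le> C1" by (simp add: C1_def)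
  have emW: "emeasure lborel \<Omega> = ennreal W"
    unfolding W_def using emeasure_bounded_finite[OF \<Omega>(2)] by (simp add: emeasure_eq_ennreal_measure)
  show thesis
  proof (rule that[of C])
    fix l U V
    assume l: "0 < l" "l \<le> m" and sys: "gelfand_system \<Omega> l U V"
      and stable: "stable_solution \<Omega> l U"
    define \<rho> where "\<rho> = (\<lambda>x. sqrt l * exp (U x / 2))"
    define s where "s = (\<lambda>x. max 0 (V x - 1))"
    define K where "K = {x. 1 \<le> V x}"
    have energy: "320 * (LINT x:K|lborel. \<rho> x * s x powr (21/5)) \<le>
        441 * (LINT x:K|lborel. (\<rho> x)\<^sup>2 * s x powr (16/5))"
      unfolding \<rho>_def s_def K_def by (rule gelfand_energy[OF \<Omega> l(1) sys stable])
    have contU: "continuous_on S U" and contV: "continuous_on S V" for S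
      using gelfand_systemD(1,2)[OF sys] by (auto intro: continuous_on_subset)
    have [measurable]: "U \<in> borel_measurable borel" "V \<in> borel_measurable borel"
      using contU contV by (auto intro: borel_measurable_continuous_onI)
    have [measurable]: "\<Omega> \<in> sets borel" using \<Omega> by simp
    have K: "compact K" "K \<subseteq> \<Omega>"
      unfolding K_def using compact_superlevel[OF \<Omega>(2) contV gelfand_systemD(4)[OF sys], of 1] by auto
    have rho: "0 < \<rho> x" for x
      using l by (simp add: \<rho>_def)
    have rho_le: "\<rho> x \<le> q * V x + sqrt m" for x
    proof -
      have "\<rho> x - sqrt l = q * (sqrt (2 * l) * (exp (U x / 2) - 1))"
        by (simp add: \<rho>_def q_def real_sqrt_mult algebra_simps)
      also have "\<dots> \<le> q * V x"
        using q by (intro mult_left_mono gelfand_pointwise[OF \<Omega> l(1) sys]) auto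
      finally show ?thesis
        using real_sqrt_le_mono[OF l(2)] by linarith
    qed
    have rho_K: "\<rho> x \<le> q * s x + c" if "x \<in> K" for x
      using rho_le[of x] that by (simp add: K_def s_def c_def algebra_simps)
    have rho_out: "\<rho> x \<le> c" if "x \<notin> K" for x
    proof -
      have "q * V x \<le> q * 1" using that q by (intro mult_left_mono) (auto simp: K_def)
      then show ?thesis using rho_le[of x] by (simp add: c_def)
    qed
    have s: "0 \<le> s x" for x by (simp add: s_def)
    have cs: "continuous_on S (\<lambda>x. s x powr r)" if "0 < r" for S r
      unfolding s_def using that by (intro continuous_max_powr continuous_intros contV)
    have int: "set_integrable lborel K (\<lambda>x. \<rho> x * s x powr (21/5))"
      "set_integrable lborel K (\<lambda>x. (\<rho> x)\<^sup>2 * s x powr (16/5))"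
      "set_integrable lborel K (\<lambda>x. C1)"
      unfolding \<rho>_def
      by (auto intro!: set_integrable_compact_continuous[OF K(1)] continuous_intros cs contU)
    \<comment> \<open>There is room since \<open>\<rho> \<approx> s/\<surd>2\<close> for large \<open>s\<close> and \<open>441/\<surd>2 < 319\<close>.\<close>
    have pw: "441 * ((\<rho> x)\<^sup>2 * s x powr (16/5)) \<le> 319 * (\<rho> x * s x powr (21/5)) + C1" if "x \<in> K" for x
    proof (cases "S \<le> s x")
      case True
      have "441 * (q * s x + c) \<le> 319 * s x"
      proof -
        have "q * s x \<le> 71/100 * s x"
          using q s[of x] by (intro mult_right_mono) auto
        moreover have "c \<le> s x / 100" using True by (simp add: S_def)
        ultimately show ?thesis using s[of x] by simp
      qed
      then have "441 * \<rho> x \<le> 319 * s x"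
        using rho_K[OF that] by simp
      then have "(\<rho> x * s x powr (16/5)) * (441 * \<rho> x) \<le> (\<rho> x * s x powr (16/5)) * (319 * s x)"
        using rho[of x] by (intro mult_left_mono) auto
      also have "s x powr (16/5) * s x = s x powr (21/5)"
        using s[of x] powr_mult_base[of "s x" "16/5"] by (simp add: mult.commute)
      then have "(\<rho> x * s x powr (16/5)) * (319 * s x) = 319 * (\<rho> x * s x powr (21/5))"
        by simp
      finally show ?thesis
        using \<open>0 \<le> C1\<close> by (simp add: power2_eq_square mult_ac)
    next
      case False
      have "\<rho> x \<le> S + c"
      proof -
        have "q * s x \<le> 1 * s x" using q s[of x] by (intro mult_right_mono) auto
        then show ?thesis using False rho_K[OF that] by simp
      qed
      then have "(\<rho> x)\<^sup>2 * s x powr (16/5) \<le> (S + c)\<^sup>2 * S powr (16/5)"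
        using False s[of x] rho[of x] by (intro mult_mono power_mono powr_mono2) auto
      then show ?thesis
        using rho[of x] by (simp add: C1_def mult.commute add_increasing)
    qed
    have "320 * (LINT x:K|lborel. \<rho> x * s x powr (21/5)) \<le>
        (LINT x:K|lborel. 441 * ((\<rho> x)\<^sup>2 * s x powr (16/5)))"
      using energy by simp
    also have "\<dots> \<le> (LINT x:K|lborel. 319 * (\<rho> x * s x powr (21/5)) + C1)"
      using int pw by (intro set_integral_mono set_integral_add(1)) auto
    also have "\<dots> = 319 * (LINT x:K|lborel. \<rho> x * s x powr (21/5)) + (LINT x:K|lborel. C1)"
      using int by (subst set_integral_add(2)) auto
    also have "(LINT x:K|lborel. C1) = C1 * measure lborel K"
      by (simp add: set_lebesgue_integral_def)
    also have "\<dots> \<le> C1 * W"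
      unfolding W_def using K \<open>0 \<le> C1\<close> emeasure_bounded_finite[OF \<Omega>(2)]
      by (intro mult_left_mono measure_mono_fmeasurable fmeasurableI) (auto simp: compact_imp_closed)
    finally have I: "(LINT x:K|lborel. \<rho> x * s x powr (21/5)) \<le> C1 * W"
      by simp
    have pw2: "ennreal ((l * exp (U x)) powr (13/5)) * indicator \<Omega> x \<le>
        ennreal (2 powr (21/5)) * ennreal (indicator K x *\<^sub>R (\<rho> x * s x powr (21/5))) +
        ennreal ((3 * c) powr (26/5)) * indicator \<Omega> x" for x
    proof (cases "x \<in> \<Omega>")
      case True
      have "l * exp (U x) = \<rho> x powr 2"
        using l rho[of x] by (simp add: \<rho>_def power_mult_distrib powr_numeral flip: exp_double)
      then have eq: "(l * exp (U x)) powr (13/5) = \<rho> x powr (26/5)"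
        by (simp add: powr_powr)
      have small: "\<rho> x powr (26/5) \<le> (3 * c) powr (26/5)" if "\<rho> x \<le> 3 * c"
        using that rho[of x] by (intro powr_mono2) auto
      \<comment> \<open>Split 26/5 = 1 + 21/5: one factor rho is kept and the others are replaced by
        2s where \<open>c \<le> s x\<close>. Elsewhere rho is at most 2c, so the constant term
        suffices.\<close>
      have "\<rho> x powr (26/5) \<le> 2 powr (21/5) * (indicator K x *\<^sub>R (\<rho> x * s x powr (21/5))) + (3 * c) powr (26/5)"
      proof (cases "x \<in> K \<and> c \<le> s x")
        case True
        then have "\<rho> x \<le> 2 * s x"
        proof -
          have "q * s x \<le> 1 * s x" using q s[of x] by (intro mult_right_mono) auto
          then show ?thesis using True rho_K[of x] by simp
        qed
        then have "\<rho> x powr (21/5) \<le> (2 * s x) powr (21/5)"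
          using rho[of x] by (intro powr_mono2) auto
        also have "\<dots> = 2 powr (21/5) * s x powr (21/5)"
          using s[of x] by (simp add: powr_mult)
        finally have "\<rho> x * \<rho> x powr (21/5) \<le> \<rho> x * (2 powr (21/5) * s x powr (21/5))"
          using rho[of x] by (intro mult_left_mono) auto
        moreover have "\<rho> x * \<rho> x powr (21/5) = \<rho> x powr (26/5)"
          using rho[of x] powr_mult_base[of "\<rho> x" "21/5"] by simp
        ultimately show ?thesis
          using True by (simp add: mult_ac add_increasing2)
      next
        case False
        have "\<rho> x \<le> 3 * c"
        proof (cases "x \<in> K")
          case True
          have "q * s x \<le> 1 * s x" using q s[of x] by (intro mult_right_mono) auto
          then show ?thesis using True False rho_K[of x] c by simp
        qed (use rho_out c in fastforce)
        then show ?thesis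
          using small rho[of x] by (simp add: add_increasing indicator_def)
      qed
      then have "ennreal (\<rho> x powr (26/5)) \<le>
          ennreal (2 powr (21/5) * (indicator K x *\<^sub>R (\<rho> x * s x powr (21/5))) + (3 * c) powr (26/5))"
        by (rule ennreal_leI)
      also have "\<dots> = ennreal (2 powr (21/5)) * ennreal (indicator K x *\<^sub>R (\<rho> x * s x powr (21/5))) +
          ennreal ((3 * c) powr (26/5))"
        using rho[of x] by (subst ennreal_plus) (auto simp: ennreal_mult' indicator_def)
      finally show ?thesis
        using True eq by simp
    qed simp
    have "(\<integral>\<^sup>+x\<in>\<Omega>. ennreal ((l * exp (U x)) powr (13/5)) \<partial>lborel) \<le>
      (\<integral>\<^sup>+x. ennreal (2 powr (21/5)) * ennreal (indicator K x *\<^sub>R (\<rho> x * s x powr (21/5))) +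
        ennreal ((3 * c) powr (26/5)) * indicator \<Omega> x \<partial>lborel)"
      by (intro nn_integral_mono pw2)
    also have "\<dots> = ennreal (2 powr (21/5)) * (\<integral>\<^sup>+x. ennreal (indicator K x *\<^sub>R (\<rho> x * s x powr (21/5))) \<partial>lborel) +
        ennreal ((3 * c) powr (26/5)) * emeasure lborel \<Omega>"
    proof -
      have [measurable]: "K \<in> sets borel" using K by (simp add: compact_imp_closed borel_closed)
      show ?thesis
        unfolding \<rho>_def s_def
        by (subst nn_integral_add, measurable) (simp add: nn_integral_cmult nn_integral_cmult_indicator)
    qed
    also have "(\<integral>\<^sup>+x. ennreal (indicator K x *\<^sub>R (\<rho> x * s x powr (21/5))) \<partial>lborel) =
        ennreal (LINT x:K|lborel. \<rho> x * s x powr (21/5))"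
      unfolding set_lebesgue_integral_def
      using int(1) less_imp_le[OF rho] by (intro nn_integral_eq_integral) (auto simp: set_integrable_def)
    also have "\<dots> \<le> ennreal (C1 * W)"
      by (rule ennreal_leI[OF I])
    also have "ennreal (2 powr (21/5)) * ennreal (C1 * W) + ennreal ((3 * c) powr (26/5)) * emeasure lborel \<Omega> = ennreal C"
      using \<open>0 \<le> C1\<close> unfolding emW C_def W_def
      by (subst ennreal_plus) (auto simp: ennreal_mult)
    finally show "(\<integral>\<^sup>+x\<in>\<Omega>. ennreal ((l * exp (U x)) powr (13/5)) \<partial>lborel) \<le> ennreal C"
      by (simp add: add_mono mult_left_mono)
  qed
qed

subsection \<open>Potential estimates\<close>

lemma has_grad_lap_dist_square:
  fixes x0 :: "'a::euclidean_space"
  shows "has_grad_lap S (\<lambda>y. (y - x0) \<bullet> (y - x0)) (\<lambda>y. 2 *\<^sub>R (y - x0)) (\<lambda>_. 2 * real DIM('a))"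
  unfolding has_grad_lap_def
proof (intro conjI ballI exI[of _ "\<lambda>e y. 2 *\<^sub>R e"])
  fix y :: 'a
  show "GDERIV (\<lambda>y. (y - x0) \<bullet> (y - x0)) y :> 2 *\<^sub>R (y - x0)"
    unfolding gderiv_def
    by (auto intro!: derivative_eq_intros simp: inner_commute algebra_simps)
  fix e :: 'a
  show "GDERIV (\<lambda>y. 2 *\<^sub>R (y - x0) \<bullet> e) y :> 2 *\<^sub>R e"
    unfolding gderiv_def by (auto intro!: derivative_eq_intros simp: inner_commute algebra_simps)
next
  show "2 * real DIM('a) = (\<Sum>e\<in>Basis. 2 *\<^sub>R e \<bullet> (e::'a))"
    by simp
qed auto

text \<open>The profile \<open>q\<close>, evaluated at the squared distance, is the fundamental solution regularised at
  scale \<open>\<surd>d\<close>. In dimension 2 it is a logarithm, shifted to be nonnegative up to distance \<open>R\<close>; any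
  negative power of the distance dominates it there.\<close>

lemma regularised_fundamental_solution:
  fixes n R :: real
  assumes "n = 1 \<or> 3/2 \<le> n" "0 < R"
  obtains C where "0 < C" "\<And>d. 0 < d \<Longrightarrow> d \<le> 1 \<Longrightarrow>
    \<exists>q. (\<forall>r\<ge>0. (q has_real_derivative - ((r + d) powr (- n))) (at r)) \<and>
        (\<forall>t. 0 \<le> t \<and> t \<le> R \<longrightarrow> 0 \<le> q (t\<^sup>2)) \<and>
        (\<forall>t. 0 < t \<and> t \<le> R \<longrightarrow> q (t\<^sup>2) \<le> C * t powr (- max 1 (2 * n - 2)))"
  using assms(1)
proof
  assume n: "n = 1"
  \<comment> \<open>For t \<le> R the constant \<open>ln (R\<^sup>2 + 1)\<close> is at most its
    multiple by R/t, and the logarithm contributes at most 2 ln(1/t) \<le> 2/t.\<close>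
  define C where "C = ln (R\<^sup>2 + 1) * R + 2"
  have pos: "0 \<le> ln (R\<^sup>2 + 1)" by simp
  show thesis
  proof (rule that[of C])
    show "0 < C" using pos \<open>0 < R\<close> by (simp add: C_def add_nonneg_pos)
    fix d :: real assume d: "0 < d" "d \<le> 1"
    show "\<exists>q. (\<forall>r\<ge>0. (q has_real_derivative - ((r + d) powr (- n))) (at r)) \<and>
        (\<forall>t. 0 \<le> t \<and> t \<le> R \<longrightarrow> 0 \<le> q (t\<^sup>2)) \<and>
        (\<forall>t. 0 < t \<and> t \<le> R \<longrightarrow> q (t\<^sup>2) \<le> C * t powr (- max 1 (2 * n - 2)))"
    \<comment> \<open>The shift is \<open>ln (R\<^sup>2 + 1)\<close> because the argument
      \<open>t\<^sup>2 + d\<close> never exceeds it inside the logarithm: t \<le> R and d \<le>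
      1.\<close>
    proof (intro exI[of _ "\<lambda>r. ln (R\<^sup>2 + 1) - ln (r + d)"] conjI allI impI)
      fix r :: real assume "0 \<le> r"
      then show "((\<lambda>r. ln (R\<^sup>2 + 1) - ln (r + d)) has_real_derivative - ((r + d) powr (- n))) (at r)"
        using d by (auto intro!: derivative_eq_intros simp: n powr_minus divide_inverse)
    next
      fix t :: real assume t: "0 \<le> t \<and> t \<le> R"
      then have "t\<^sup>2 \<le> R\<^sup>2" by (intro power_mono) auto
      then show "0 \<le> ln (R\<^sup>2 + 1) - ln (t\<^sup>2 + d)"
        using d by (simp add: add_nonneg_pos add_mono)
    next
      fix t :: real assume t: "0 < t \<and> t \<le> R"
      have "ln (t\<^sup>2) \<le> ln (t\<^sup>2 + d)"
        using t d by (intro ln_mono) auto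
      then have "- ln (t\<^sup>2 + d) \<le> - (2 * ln t)"
        using t by (simp add: ln_realpow)
      also have "\<dots> = 2 * ln (1 / t)"
        using t by (simp add: ln_div)
      also have "\<dots> \<le> 2 * (1 / t)"
        using t ln_le_minus_one[of "1 / t"] by simp
      finally have "ln (R\<^sup>2 + 1) - ln (t\<^sup>2 + d) \<le> ln (R\<^sup>2 + 1) * 1 + 2 / t"
        by simp
      also have "ln (R\<^sup>2 + 1) * 1 \<le> ln (R\<^sup>2 + 1) * (R / t)"
        using t pos by (intro mult_left_mono) auto
      finally have "ln (R\<^sup>2 + 1) - ln (t\<^sup>2 + d) \<le> C / t"
        by (simp add: C_def add_divide_distrib)
      then show "ln (R\<^sup>2 + 1) - ln (t\<^sup>2 + d) \<le> C * t powr (- max 1 (2 * n - 2))"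
        using t by (simp add: n powr_minus divide_inverse)
    qed
  qed
next
  assume n: "3/2 \<le> n"
  show thesis
  proof (rule that[of "1 / (n - 1)"])
    show "0 < 1 / (n - 1)" using n by simp
    fix d :: real assume d: "0 < d" "d \<le> 1"
    show "\<exists>q. (\<forall>r\<ge>0. (q has_real_derivative - ((r + d) powr (- n))) (at r)) \<and>
        (\<forall>t. 0 \<le> t \<and> t \<le> R \<longrightarrow> 0 \<le> q (t\<^sup>2)) \<and>
        (\<forall>t. 0 < t \<and> t \<le> R \<longrightarrow> q (t\<^sup>2) \<le> 1 / (n - 1) * t powr (- max 1 (2 * n - 2)))"
    proof (intro exI[of _ "\<lambda>r. 1 / (n - 1) * (r + d) powr (1 - n)"] conjI allI impI)
      fix r :: real assume "0 \<le> r"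
      then have "((\<lambda>r. (r + d) powr (1 - n)) has_real_derivative (1 - n) * (r + d) powr (- n)) (at r)"
        using d by (auto intro!: derivative_eq_intros)
      from DERIV_cmult[OF this, of "1 / (n - 1)"]
      have "((\<lambda>r. 1 / (n - 1) * (r + d) powr (1 - n)) has_real_derivative
          1 / (n - 1) * ((1 - n) * (r + d) powr (- n))) (at r)" .
      moreover have "1 / (n - 1) * ((1 - n) * a) = - a" for a
        using n by (simp add: field_simps)
      ultimately show "((\<lambda>r. 1 / (n - 1) * (r + d) powr (1 - n)) has_real_derivative - ((r + d) powr (- n))) (at r)"
        by (simp only:)
    next
      fix t :: real
      show "0 \<le> 1 / (n - 1) * (t\<^sup>2 + d) powr (1 - n)"
        using n by simp
    next
      fix t :: real assume t: "0 < t \<and> t \<le> R"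
      have "(t\<^sup>2 + d) powr (1 - n) \<le> (t\<^sup>2) powr (1 - n)"
        using t d n by (intro powr_mono2') auto
      also have "(t\<^sup>2) powr (1 - n) = (t powr 2) powr (1 - n)"
        using t by (simp add: powr_numeral)
      also have "\<dots> = t powr (- max 1 (2 * n - 2))"
        using n by (simp add: powr_powr max_def algebra_simps)
      finally show "1 / (n - 1) * (t\<^sup>2 + d) powr (1 - n) \<le> 1 / (n - 1) * t powr (- max 1 (2 * n - 2))"
        using n by (intro mult_left_mono) auto
    qed
  qed
qed

text \<open>For a function q of r = |y - x0|^2 the Laplacian is 4 r q'' + 2 N q'. With q' = -(r +
  d)^(-n) and n = N/2 the leading parts cancel and leave minus an approximate delta at scale sqrt d:
  a positive bump whose total mass over the whole space does not depend on d, by scaling.\<close>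

lemma laplacian_regularised_kernel:
  fixes x0 :: "'a::euclidean_space"
  assumes "0 < d" and n: "n = real DIM('a) / 2"
    and q: "\<And>r. 0 \<le> r \<Longrightarrow> (q has_real_derivative - ((r + d) powr (- n))) (at r)"
  shows "has_grad_lap S (\<lambda>y. q ((y - x0) \<bullet> (y - x0)))
    (\<lambda>y. (- (((y - x0) \<bullet> (y - x0) + d) powr (- n))) *\<^sub>R (2 *\<^sub>R (y - x0)))
    (\<lambda>y. - (4 * n * d * ((y - x0) \<bullet> (y - x0) + d) powr (- n - 1)))"
proof -
  let ?r = "\<lambda>y. (y - x0) \<bullet> (y - x0)"
  have eq: "n * (r + d) powr (- n - 1) * (4 * r) + - ((r + d) powr (- n)) * (2 * real DIM('a)) =
      - (4 * n * d * (r + d) powr (- n - 1))" if "0 \<le> r" for r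
  proof -
    have "(r + d) powr (- n) = (r + d) * (r + d) powr (- n - 1)"
      using that \<open>0 < d\<close> powr_mult_base[of "r + d" "- n - 1"] by simp
    then show ?thesis
      by (simp only:) (simp add: n algebra_simps)
  qed
  have "has_grad_lap S (\<lambda>y. q (?r y)) (\<lambda>y. (- ((?r y + d) powr (- n))) *\<^sub>R (2 *\<^sub>R (y - x0)))
    (\<lambda>y. n * (?r y + d) powr (- n - 1) * (2 *\<^sub>R (y - x0) \<bullet> 2 *\<^sub>R (y - x0)) +
      - ((?r y + d) powr (- n)) * (2 * real DIM('a)))"
  proof (rule has_grad_lap_compose[OF has_grad_lap_dist_square, where g=q and
        g'="\<lambda>r. - ((r + d) powr (- n))" and g''="\<lambda>r. n * (r + d) powr (- n - 1)"])
    fix y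
    have pos: "0 < ?r y + d" using \<open>0 < d\<close> by (simp add: add_nonneg_pos)
    show "(q has_real_derivative - ((?r y + d) powr (- n))) (at (?r y))"
      by (rule q) simp
    show "((\<lambda>r. - ((r + d) powr (- n))) has_real_derivative n * (?r y + d) powr (- n - 1)) (at (?r y))"
      using pos by (auto intro!: derivative_eq_intros)
  next
    have "?r y + d \<noteq> 0" for y using \<open>0 < d\<close> inner_ge_zero[of "y - x0"] by linarith
    then show "continuous_on S (\<lambda>y. n * (?r y + d) powr (- n - 1))"
      by (intro continuous_intros) auto
  qed
  then show ?thesis
    using eq[OF inner_ge_zero, of "_ - x0"] by simp
qed

text \<open>The convex function \<open>s - arctan s\<close> of \<open>s = t\<^sub>+\<close> is \<open>C\<^sup>2\<close> with slope at most \<open>1\<close>, and differs from \<open>s\<close>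
  by less than \<open>\<pi>/2\<close>.\<close>

lemma DERIV_convex_truncation:
  "((\<lambda>t. max 0 t - arctan (max 0 t)) has_real_derivative (max 0 t)\<^sup>2 / (1 + (max 0 t)\<^sup>2)) (at t)"
  "((\<lambda>t. (max 0 t)\<^sup>2 / (1 + (max 0 t)\<^sup>2)) has_real_derivative
    2 * max 0 t / (1 + (max 0 t)\<^sup>2)\<^sup>2) (at t)"
proof -
  have pos: "0 < 1 + t\<^sup>2" for t :: real by (simp add: add_pos_nonneg)
  have nz: "1 + t\<^sup>2 \<noteq> 0" for t :: real using pos[of t] by simp
  show "((\<lambda>t. max 0 t - arctan (max 0 t)) has_real_derivative (max 0 t)\<^sup>2 / (1 + (max 0 t)\<^sup>2)) (at t)"
  proof (rule DERIV_truncate[where g="\<lambda>t. t - arctan t" and g'="\<lambda>t. t\<^sup>2 / (1 + t\<^sup>2)"])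
    fix t :: real
    show "((\<lambda>t. t - arctan t) has_real_derivative t\<^sup>2 / (1 + t\<^sup>2)) (at t within {0..})"
      using nz[of t] by (auto intro!: derivative_eq_intros simp: field_simps)
  qed simp
  show "((\<lambda>t. (max 0 t)\<^sup>2 / (1 + (max 0 t)\<^sup>2)) has_real_derivative
    2 * max 0 t / (1 + (max 0 t)\<^sup>2)\<^sup>2) (at t)"
  proof (rule DERIV_truncate[where g="\<lambda>t. t\<^sup>2 / (1 + t\<^sup>2)" and g'="\<lambda>t. 2 * t / (1 + t\<^sup>2)\<^sup>2"])
    fix t :: real
    show "((\<lambda>t. t\<^sup>2 / (1 + t\<^sup>2)) has_real_derivative 2 * t / (1 + t\<^sup>2)\<^sup>2) (at t within {0..})"
      using nz[of t] by (auto intro!: derivative_eq_intros simp: power2_eq_square algebra_simps)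
  qed simp
qed

text \<open>Kato's inequality tested against a nonnegative kernel. Write X for the convex truncation
  of w - 1, p and p' for its first two derivatives along w. Then -\<Delta>X = p h - p' |\<nabla>w|^2
  \<le> h, since 0 \<le> p \<le> 1 and p' \<ge> 0. As X has compact support, -\<Delta> moves over to
  \<Gamma> without boundary terms. This is done by testing the equation of \<open>w\<close> with
  \<Gamma> p and that of \<Gamma> with X; the mixed gradient terms cancel.\<close>

lemma truncated_green_inequality:
  fixes \<Omega> :: "'a::euclidean_space set"
  assumes \<Omega>: "open \<Omega>" "bounded \<Omega>"
    and w: "continuous_on UNIV w" "\<And>x. x \<notin> \<Omega> \<Longrightarrow> w x = 0"
    and G: "has_grad_lap \<Omega> w G (\<lambda>x. - h x)" and h: "\<And>x. x \<in> \<Omega> \<Longrightarrow> 0 \<le> h x"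
    and \<Gamma>: "has_grad_lap \<Omega> \<Gamma> G' (\<lambda>x. - B x)" and pos: "\<And>x. x \<in> \<Omega> \<Longrightarrow> 0 \<le> \<Gamma> x"
  defines "K \<equiv> {x. 1 \<le> w x}"
  shows "(LINT x:K|lborel. (max 0 (w x - 1) - arctan (max 0 (w x - 1))) * B x) \<le>
    (LINT x:K|lborel. \<Gamma> x * h x)"
proof -
  have K: "compact K" "K \<subseteq> \<Omega>"
    unfolding K_def using compact_superlevel[OF \<Omega>(2) w, of 1] by auto
  define s where "s x = max 0 (w x - 1)" for x
  define p where "p x = (s x)\<^sup>2 / (1 + (s x)\<^sup>2)" for x
  define X where "X x = s x - arctan (s x)" for x
  define p' where "p' x = 2 * s x / (1 + (s x)\<^sup>2)\<^sup>2" for x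
  have nz: "1 + (s x)\<^sup>2 \<noteq> 0" for x
    by (metis add_pos_nonneg less_irrefl zero_le_power2 zero_less_one)
  have chi: "0 \<le> p x" "p x \<le> 1" "0 \<le> p' x" for x
    by (auto simp: p_def p'_def s_def divide_le_eq_1 add_pos_nonneg)
  have zero: "X x = 0" "p x = 0" if "x \<notin> K" for x
    using that by (auto simp: K_def s_def X_def p_def)
  have d: "((\<lambda>t. (max 0 (t - 1)) - arctan (max 0 (t - 1))) has_real_derivative p x) (at (w x))"
      "((\<lambda>t. (max 0 (t - 1))\<^sup>2 / (1 + (max 0 (t - 1))\<^sup>2)) has_real_derivative p' x) (at (w x))" for x
    using DERIV_shift[of "\<lambda>t. max 0 t - arctan (max 0 t)" "p x" "w x" "-1"]
      DERIV_shift[of "\<lambda>t. (max 0 t)\<^sup>2 / (1 + (max 0 t)\<^sup>2)" "p' x" "w x" "-1"]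
      DERIV_convex_truncation[of "w x - 1"]
    by (simp_all add: p_def p'_def s_def)
  have dX: "GDERIV X x :> p x *\<^sub>R G x" and dchi: "GDERIV p x :> p' x *\<^sub>R G x" if "x \<in> \<Omega>" for x
    using GDERIV_DERIV_compose[OF has_grad_lapD1[OF G that] d(1)]
      GDERIV_DERIV_compose[OF has_grad_lapD1[OF G that] d(2)]
    by (simp_all add: X_def[abs_def] p_def[abs_def] s_def[abs_def])
  have cs: "continuous_on S s" for S
    unfolding s_def by (intro continuous_intros continuous_on_subset[OF w(1)]) auto
  have cX: "continuous_on S X" "continuous_on S p" "continuous_on S p'" for S
    unfolding X_def p_def p'_def using nz by (auto intro!: continuous_intros cs)
  note cG = has_grad_lap_continuous[OF G] and cG' = has_grad_lap_continuous[OF \<Gamma>]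
  have ch: "continuous_on \<Omega> h" "continuous_on \<Omega> B"
    using continuous_on_minus[OF cG(3)] continuous_on_minus[OF cG'(3)] by simp_all
  have i1: "set_integrable lborel K (\<lambda>x. (\<Gamma> x *\<^sub>R (p' x *\<^sub>R G x) + p x *\<^sub>R G' x) \<bullet> G x + \<Gamma> x * p x * (- h x))"
     "(LINT x:K|lborel. (\<Gamma> x *\<^sub>R (p' x *\<^sub>R G x) + p x *\<^sub>R G' x) \<bullet> G x + \<Gamma> x * p x * (- h x)) = 0"
    by (rule integration_by_parts[OF \<Omega>(1) K G GDERIV_mult[OF has_grad_lapD1[OF \<Gamma>] dchi]];
        (intro continuous_intros cX cG cG')?; simp add: zero)+
  have i2: "set_integrable lborel K (\<lambda>x. (p x *\<^sub>R G x) \<bullet> G' x + X x * (- B x))"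
     "(LINT x:K|lborel. (p x *\<^sub>R G x) \<bullet> G' x + X x * (- B x)) = 0"
    by (rule integration_by_parts[OF \<Omega>(1) K \<Gamma> dX];
        (intro continuous_intros cX cG cG')?; simp add: zero)+
  have i3: "set_integrable lborel K (\<lambda>x. X x * B x)" "set_integrable lborel K (\<lambda>x. \<Gamma> x * h x)"
    using continuous_on_subset[OF ch(1) K(2)] continuous_on_subset[OF ch(2) K(2)]
      continuous_on_subset[OF cG'(1) K(2)]
    by (auto intro!: set_integrable_compact_continuous[OF K(1)] continuous_intros cX)
  have "(LINT x:K|lborel. X x * B x) = (LINT x:K|lborel. X x * B x) +
      (LINT x:K|lborel. (p x *\<^sub>R G x) \<bullet> G' x + X x * (- B x)) -
      (LINT x:K|lborel. (\<Gamma> x *\<^sub>R (p' x *\<^sub>R G x) + p x *\<^sub>R G' x) \<bullet> G x + \<Gamma> x * p x * (- h x))"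
    using i1(2) i2(2) by linarith
  also have "\<dots> = (LINT x:K|lborel. X x * B x + ((p x *\<^sub>R G x) \<bullet> G' x + X x * (- B x)) -
      ((\<Gamma> x *\<^sub>R (p' x *\<^sub>R G x) + p x *\<^sub>R G' x) \<bullet> G x + \<Gamma> x * p x * (- h x)))"
    by (subst set_integral_diff(2)[OF set_integral_add(1)[OF i3(1) i2(1)] i1(1)],
        subst set_integral_add(2)[OF i3(1) i2(1)]) (rule refl)
  also have "\<dots> \<le> (LINT x:K|lborel. \<Gamma> x * h x)"
  proof (rule set_integral_mono[OF set_integral_diff(1)[OF set_integral_add(1)[OF i3(1) i2(1)] i1(1)] i3(2)])
    fix x assume "x \<in> K"
    then have x: "x \<in> \<Omega>" using K by auto
    have "X x * B x + ((p x *\<^sub>R G x) \<bullet> G' x + X x * (- B x)) -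
      ((\<Gamma> x *\<^sub>R (p' x *\<^sub>R G x) + p x *\<^sub>R G' x) \<bullet> G x + \<Gamma> x * p x * (- h x)) =
      p x * (\<Gamma> x * h x) - \<Gamma> x * p' x * (G x \<bullet> G x)"
      by (simp add: inner_add_left inner_commute algebra_simps)
    also have "\<dots> \<le> p x * (\<Gamma> x * h x)"
      using pos[OF x] chi by simp
    also have "\<dots> \<le> 1 * (\<Gamma> x * h x)"
      using pos[OF x] h[OF x] chi by (intro mult_right_mono) auto
    finally show "X x * B x + ((p x *\<^sub>R G x) \<bullet> G' x + X x * (- B x)) -
      ((\<Gamma> x *\<^sub>R (p' x *\<^sub>R G x) + p x *\<^sub>R G' x) \<bullet> G x + \<Gamma> x * p x * (- h x)) \<le> \<Gamma> x * h x"
      by simp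
  qed
  finally show ?thesis
    by (simp add: X_def s_def)
qed

text \<open>A mean value argument at one scale. Choose a ball around \<open>x0\<close> on which
  \<open>w\<close> drops by at most 1, and regularise the kernel at its radius. The bump
  \<open>B\<close> then has mass at least \<open>c0\<close> on that ball, so \<integral> X B is at
  least c0 (w x0 - 4), while Green's inequality bounds it by the potential of \<open>h\<close>.
  Neither \<open>c0\<close> nor \<open>Cq\<close> depends on the radius, so the unknown modulus of
  continuity of \<open>w\<close> leaves no trace in \<open>C\<close>.\<close>

lemma potential_bound:
  fixes \<Omega> :: "'a::euclidean_space set"
  assumes \<Omega>: "open \<Omega>" "bounded \<Omega>" and dim: "2 \<le> DIM('a)"
  obtains C where "0 < C" "\<And>w h G x0. continuous_on UNIV w \<Longrightarrow> \<forall>x. x \<notin> \<Omega> \<longrightarrow> w x = 0 \<Longrightarrow>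
    has_grad_lap \<Omega> w G (\<lambda>x. - h x) \<Longrightarrow> \<forall>x\<in>\<Omega>. 0 \<le> h x \<Longrightarrow> x0 \<in> \<Omega> \<Longrightarrow>
    ennreal (w x0) \<le> ennreal C *
      (1 + (\<integral>\<^sup>+y\<in>\<Omega>. ennreal (norm (x0 - y) powr (- max 1 (real DIM('a) - 2)) * h y) \<partial>lborel))"
proof -
  define n where "n = real DIM('a) / 2"
  have n: "n = 1 \<or> 3/2 \<le> n" "0 < n" "2 * n = real DIM('a)"
    using dim by (auto simp: n_def)
  define \<beta> where "\<beta> = max 1 (real DIM('a) - 2)"
  obtain R0 where R0: "\<And>x. x \<in> \<Omega> \<Longrightarrow> norm x \<le> R0" "0 < R0"
    using \<Omega>(2) unfolding bounded_pos by blast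
  define R where "R = 2 * R0"
  have R: "0 < R" "\<And>x y. x \<in> \<Omega> \<Longrightarrow> y \<in> \<Omega> \<Longrightarrow> norm (x - y) \<le> R"
  proof -
    show "0 < R" using R0 by (simp add: R_def)
    fix x y assume "x \<in> \<Omega>" "y \<in> \<Omega>"
    then show "norm (x - y) \<le> R"
      using R0(1)[of x] R0(1)[of y] norm_triangle_ineq4[of x y] by (simp add: R_def)
  qed
  obtain Cq where Cq: "0 < Cq" "\<And>d. 0 < d \<Longrightarrow> d \<le> 1 \<Longrightarrow>
    \<exists>q. (\<forall>r\<ge>0. (q has_real_derivative - ((r + d) powr (- n))) (at r)) \<and>
        (\<forall>t. 0 \<le> t \<and> t \<le> R \<longrightarrow> 0 \<le> q (t\<^sup>2)) \<and>
        (\<forall>t. 0 < t \<and> t \<le> R \<longrightarrow> q (t\<^sup>2) \<le> Cq * t powr (- max 1 (2 * n - 2)))"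
    by (rule regularised_fundamental_solution[OF n(1) R(1)]) (rule that)
  define c0 where "c0 = 4 * n * 2 powr (- n - 1) * unit_ball_vol (real DIM('a))"
  have c0: "0 < c0"
    using n by (simp add: c0_def)
  define C where "C = max 4 (Cq / c0)"
  show thesis
  proof (rule that[of C])
    show "0 < C" by (simp add: C_def)
    fix w h G x0
    assume w': "continuous_on UNIV w" "\<forall>x. x \<notin> \<Omega> \<longrightarrow> w x = 0"
      and G: "has_grad_lap \<Omega> w G (\<lambda>x. - h x)" and h': "\<forall>x\<in>\<Omega>. 0 \<le> h x" and x0: "x0 \<in> \<Omega>"
    note w = w'[rule_format] and h = h'[rule_format]
    let ?I = "\<integral>\<^sup>+y\<in>\<Omega>. ennreal (norm (x0 - y) powr (- \<beta>) * h y) \<partial>lborel"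
    show "ennreal (w x0) \<le> ennreal C *
      (1 + (\<integral>\<^sup>+y\<in>\<Omega>. ennreal (norm (x0 - y) powr (- max 1 (real DIM('a) - 2)) * h y) \<partial>lborel))"
      unfolding \<beta>_def[symmetric]
    proof (cases "w x0 \<le> 4")
      case True
      then have "ennreal (w x0) \<le> ennreal C * 1"
        by (simp add: C_def le_max_iff_disj)
      also have "\<dots> \<le> ennreal C * (1 + ?I)"
        by (intro mult_left_mono) auto
      finally show "ennreal (w x0) \<le> ennreal C * (1 + ?I)" .
    next
      case False
      define K where "K = {x. 1 \<le> w x}"
      have K: "compact K" "K \<subseteq> \<Omega>"
        unfolding K_def using compact_superlevel[OF \<Omega>(2) w, of 1] by auto
      have "isCont w x0"
        using w(1) by (simp add: continuous_on_eq_continuous_at)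
      then obtain \<rho>0 where \<rho>0: "0 < \<rho>0" "\<And>y. dist y x0 < \<rho>0 \<Longrightarrow> dist (w y) (w x0) < 1"
        unfolding continuous_at_eps_delta by (metis dist_norm zero_less_one)
      define \<rho> where "\<rho> = min 1 \<rho>0"
      have \<rho>: "0 < \<rho>" "\<rho> \<le> 1" and w_ball: "\<And>y. y \<in> ball x0 \<rho> \<Longrightarrow> w x0 - 1 \<le> w y"
        using \<rho>0 by (auto simp: \<rho>_def dist_commute dist_real_def abs_less_iff less_imp_le)
          (smt (verit) \<rho>0(2) dist_commute dist_real_def)
      define d where "d = \<rho>\<^sup>2"
      have d: "0 < d" "d \<le> 1"
        using \<rho> by (auto simp: d_def power_le_one)
      obtain q where q: "\<And>r. 0 \<le> r \<Longrightarrow> (q has_real_derivative - ((r + d) powr (- n))) (at r)"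
        "\<And>t. 0 \<le> t \<Longrightarrow> t \<le> R \<Longrightarrow> 0 \<le> q (t\<^sup>2)"
        "\<And>t. 0 < t \<Longrightarrow> t \<le> R \<Longrightarrow> q (t\<^sup>2) \<le> Cq * t powr (- \<beta>)"
        using Cq(2)[OF d] unfolding n(3) \<beta>_def[symmetric] by blast
      define \<Gamma> where "\<Gamma> y = q ((y - x0) \<bullet> (y - x0))" for y
      define B where "B y = 4 * n * d * ((y - x0) \<bullet> (y - x0) + d) powr (- n - 1)" for y
      have Gam: "has_grad_lap \<Omega> \<Gamma> (\<lambda>y. (- (((y - x0) \<bullet> (y - x0) + d) powr (- n))) *\<^sub>R (2 *\<^sub>R (y - x0)))
          (\<lambda>y. - B y)"
        unfolding \<Gamma>_def B_def by (rule laplacian_regularised_kernel[OF d(1) n_def q(1)])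
      have Gam_eq: "\<Gamma> y = q ((norm (x0 - y))\<^sup>2)" for y
        by (simp add: \<Gamma>_def dot_square_norm norm_minus_commute)
      have Gam_pos: "0 \<le> \<Gamma> y" if "y \<in> \<Omega>" for y
        unfolding Gam_eq by (rule q(2)[OF norm_ge_zero R(2)[OF x0 that]])
      define X where "X y = max 0 (w y - 1) - arctan (max 0 (w y - 1))" for y
      have green: "(LINT y:K|lborel. X y * B y) \<le> (LINT y:K|lborel. \<Gamma> y * h y)"
        unfolding K_def X_def by (rule truncated_green_inequality[OF \<Omega> w G h Gam Gam_pos])
      have ball: "ball x0 \<rho> \<subseteq> K"
        using w_ball False by (fastforce simp: K_def)
      have cX: "continuous_on S X" for S
        unfolding X_def by (intro continuous_intros continuous_on_subset[OF w(1)]) auto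
      have cB: "continuous_on K B" "continuous_on K \<Gamma>" "continuous_on K h"
        using continuous_on_minus[OF has_grad_lap_continuous(3)[OF Gam]] K(2)
          continuous_on_minus[OF has_grad_lap_continuous(3)[OF G]] has_grad_lap_continuous(1)[OF Gam]
        by (auto intro: continuous_on_subset)
      have int: "set_integrable lborel K (\<lambda>y. X y * B y)" "set_integrable lborel K (\<lambda>y. \<Gamma> y * h y)"
        by (intro set_integrable_compact_continuous[OF K(1)] continuous_intros cX cB)+
      \<comment> \<open>The value of \<open>B\<close> at distance sqrt d from the centre, hence its
        minimum over the ball.\<close>
      define b where "b = 4 * n * 2 powr (- n - 1) * d powr (- n)"
      have "0 \<le> b" using n by (simp add: b_def)
      have B_ball: "b \<le> B y" if "y \<in> ball x0 \<rho>" for y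
      proof -
        have "(y - x0) \<bullet> (y - x0) = (dist x0 y)\<^sup>2"
          by (simp add: dot_square_norm dist_norm norm_minus_commute)
        also have "\<dots> \<le> d"
          unfolding d_def using that by (intro power_mono) auto
        finally have "(2 * d) powr (- n - 1) \<le> ((y - x0) \<bullet> (y - x0) + d) powr (- n - 1)"
          using n d by (intro powr_mono2') (auto simp: add_nonneg_pos)
        then have "4 * n * d * (2 * d) powr (- n - 1) \<le> B y"
          unfolding B_def using n d by (intro mult_left_mono) auto
        moreover have "d * (2 * d) powr (- n - 1) = 2 powr (- n - 1) * d powr (- n)"
          using d powr_mult_base[of d "- n - 1"] by (simp add: powr_mult)
        ultimately show ?thesis
          by (simp add: b_def mult.assoc)
      qed
      have X_pos: "0 \<le> X y" for y
        unfolding X_def using arctan_le_self[of "max 0 (w y - 1)"] by simp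
      have B_pos: "0 \<le> B y" for y
        unfolding B_def using n d by simp
      \<comment> \<open>The loss 4 is 1 for truncating at level 1, 1 for the oscillation of
        \<open>w\<close> on the ball, and 2 as a bound for the arctangent.\<close>
      have X_ball: "w x0 - 4 \<le> X y" if "y \<in> ball x0 \<rho>" for y
      proof -
        have "arctan (max 0 (w y - 1)) < 2"
          using arctan_ubound[of "max 0 (w y - 1)"] pi_less_4 by linarith
        then show ?thesis
          using w_ball[OF that] by (simp add: X_def)
      qed
      have "c0 * (w x0 - 4) = (w x0 - 4) * b * measure lborel (ball x0 \<rho>)"
      proof -
        \<comment> \<open>Here 2n is the dimension and d the squared radius, so the radius drops out
          of \<open>b\<close> times the volume of the ball.\<close>
        have "d powr (- n) * \<rho> ^ DIM('a) = 1"
        proof -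
          have "d powr n = (\<rho> powr 2) powr n"
            using \<rho> by (simp add: d_def powr_numeral)
          also have "\<dots> = \<rho> ^ DIM('a)"
            by (simp only: powr_powr n(3) powr_realpow[OF \<rho>(1)])
          finally show ?thesis
            using d \<rho> by (simp add: powr_minus field_simps)
        qed
        then have "b * measure lborel (ball x0 \<rho>) = c0"
          using \<rho> by (simp add: content_ball b_def c0_def mult_ac)
        then show ?thesis by (simp add: mult_ac)
      qed
      also have "\<dots> = (LINT y:ball x0 \<rho>|lborel. (w x0 - 4) * b)"
        by (simp add: set_lebesgue_integral_def)
      also have "\<dots> \<le> (LINT y:K|lborel. X y * B y)"
        unfolding set_lebesgue_integral_def
      proof (rule integral_mono)
        show "integrable lborel (\<lambda>y. indicator K y *\<^sub>R (X y * B y))"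
          using int(1) by (simp add: set_integrable_def)
        show "integrable lborel (\<lambda>y. indicator (ball x0 \<rho>) y *\<^sub>R ((w x0 - 4) * b))"
          using emeasure_bounded_finite[OF bounded_ball, of x0 \<rho>] by simp
        show "indicator (ball x0 \<rho>) y *\<^sub>R ((w x0 - 4) * b) \<le> indicator K y *\<^sub>R (X y * B y)" for y
        proof (cases "y \<in> ball x0 \<rho>")
          case True
          then have "(w x0 - 4) * b \<le> X y * B y"
            using X_ball B_ball X_pos \<open>0 \<le> b\<close> by (intro mult_mono) auto
          then show ?thesis using True ball by auto
        qed (simp add: X_pos B_pos)
      qed
      finally have "c0 * (w x0 - 4) \<le> (LINT y:K|lborel. \<Gamma> y * h y)"
        using green by simp
      then have "ennreal (c0 * (w x0 - 4)) \<le> ennreal (LINT y:K|lborel. \<Gamma> y * h y)"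
        by (rule ennreal_leI)
      also have "\<dots> = (\<integral>\<^sup>+y. ennreal (indicator K y *\<^sub>R (\<Gamma> y * h y)) \<partial>lborel)"
        unfolding set_lebesgue_integral_def using int(2) Gam_pos h K(2)
        by (intro nn_integral_eq_integral[symmetric])
           (auto simp: set_integrable_def indicator_def intro!: mult_nonneg_nonneg)
      also have "\<dots> \<le> (\<integral>\<^sup>+y. ennreal Cq * (ennreal (norm (x0 - y) powr (- \<beta>) * h y) * indicator \<Omega> y) \<partial>lborel)"
      proof (rule nn_integral_mono_AE)
        show "AE y in lborel. ennreal (indicator K y *\<^sub>R (\<Gamma> y * h y)) \<le>
            ennreal Cq * (ennreal (norm (x0 - y) powr (- \<beta>) * h y) * indicator \<Omega> y)"
          \<comment> \<open>The centre has to be excluded: there \<open>0 powr (- \<beta>)\<close>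
            is 0, so the right side vanishes while \<Gamma> may be positive.\<close>
          using AE_lborel_singleton[of x0]
        proof eventually_elim
          fix y assume "y \<noteq> x0"
          show "ennreal (indicator K y *\<^sub>R (\<Gamma> y * h y)) \<le>
              ennreal Cq * (ennreal (norm (x0 - y) powr (- \<beta>) * h y) * indicator \<Omega> y)"
          proof (cases "y \<in> K")
            case True
            then have y: "y \<in> \<Omega>" using K by auto
            have "\<Gamma> y \<le> Cq * norm (x0 - y) powr (- \<beta>)"
              unfolding Gam_eq using \<open>y \<noteq> x0\<close> by (intro q(3) R(2) x0 y) auto
            then have "\<Gamma> y * h y \<le> Cq * norm (x0 - y) powr (- \<beta>) * h y"
              using h[OF y] by (rule mult_right_mono)
            then have "ennreal (\<Gamma> y * h y) \<le> ennreal (Cq * (norm (x0 - y) powr (- \<beta>) * h y))"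
              by (intro ennreal_leI) (simp add: mult_ac)
            also have "\<dots> = ennreal Cq * ennreal (norm (x0 - y) powr (- \<beta>) * h y)"
              using Cq(1) by (intro ennreal_mult') simp
            finally show ?thesis
              using True y by simp
          qed simp
        qed
      qed
      also have "\<dots> = ennreal Cq * ?I"
      proof (rule nn_integral_cmult)
        \<comment> \<open>Outside the domain \<open>h\<close> is arbitrary; measurability is
          obtained for its extension by 0.\<close>
        have "(\<lambda>y. if y \<in> \<Omega> then h y else 0) \<in> borel_measurable borel"
          using continuous_on_minus[OF has_grad_lap_continuous(3)[OF G]] \<Omega>(1)
          by (intro borel_measurable_continuous_on_if) auto
        then have "(\<lambda>y. ennreal (norm (x0 - y) powr (- \<beta>) * (if y \<in> \<Omega> then h y else 0))) \<in> borel_measurable lborel"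
          by measurable
        also have "(\<lambda>y. ennreal (norm (x0 - y) powr (- \<beta>) * (if y \<in> \<Omega> then h y else 0))) =
            (\<lambda>y. ennreal (norm (x0 - y) powr (- \<beta>) * h y) * indicator \<Omega> y)"
          by (auto simp: fun_eq_iff)
        finally show "(\<lambda>y. ennreal (norm (x0 - y) powr (- \<beta>) * h y) * indicator \<Omega> y) \<in> borel_measurable lborel" .
      qed
      finally have *: "ennreal (c0 * (w x0 - 4)) \<le> ennreal Cq * ?I" .
      have "ennreal (w x0) = ennreal 4 + ennreal (1 / c0) * ennreal (c0 * (w x0 - 4))"
      proof -
        have "ennreal (w x0) = ennreal (4 + 1 / c0 * (c0 * (w x0 - 4)))"
          using c0 by simp
        also have "\<dots> = ennreal 4 + ennreal (1 / c0 * (c0 * (w x0 - 4)))"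
          using False c0 by (intro ennreal_plus) auto
        also have "ennreal (1 / c0 * (c0 * (w x0 - 4))) = ennreal (1 / c0) * ennreal (c0 * (w x0 - 4))"
          using c0 by (intro ennreal_mult') simp
        finally show ?thesis .
      qed
      also have "\<dots> \<le> ennreal 4 + ennreal (1 / c0) * (ennreal Cq * ?I)"
        by (intro add_left_mono mult_left_mono *) simp
      also have "\<dots> = ennreal 4 * 1 + ennreal (Cq / c0) * ?I"
        using c0 Cq(1) by (simp add: ennreal_mult'[symmetric] flip: mult.assoc)
      also have "\<dots> \<le> ennreal C * 1 + ennreal C * ?I"
        by (intro add_mono mult_right_mono ennreal_leI) (auto simp: C_def)
      finally show "ennreal (w x0) \<le> ennreal C * (1 + ?I)"
        by (simp add: distrib_left)
    qed
  qed
qed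

text \<open>Dyadic decomposition around x. Where R/2^(k+1) < |x - y| \<le> R/2^k, the kernel is at
  most (R/2^(k+1))^(-s); replacing each shell by its full ball gives terms A \<theta>^k with ratio
  \<theta> = 2^(s-N), below 1 because s < N.\<close>

lemma nn_integral_norm_powr_bound:
  fixes s R :: real
  assumes "0 \<le> s" "s < real DIM('a::euclidean_space)" "0 < R"
  obtains C where "0 \<le> C"
    "\<And>x::'a. (\<integral>\<^sup>+y. ennreal (norm (x - y) powr (- s)) * indicator (cball x R) y \<partial>lborel) \<le> ennreal C"
proof -
  define \<theta> where "\<theta> = 2 powr s / 2 ^ DIM('a)"
  have "2 powr s < 2 powr (real DIM('a))"
    using assms by (intro powr_less_mono) auto
  then have \<theta>: "0 \<le> \<theta>" "\<theta> < 1"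
    by (auto simp: \<theta>_def powr_realpow)
  define A where "A = (R / 2) powr (- s) * (unit_ball_vol (real DIM('a)) * R ^ DIM('a))"
  have A: "0 \<le> A" using \<open>0 < R\<close> by (simp add: A_def)
  show thesis
  proof (rule that[of "A * (1 / (1 - \<theta>))"])
    show "0 \<le> A * (1 / (1 - \<theta>))" using A \<theta> by simp
    fix x :: 'a
    define g where "g k y = ennreal ((R / 2 ^ Suc k) powr (- s)) * indicator (cball x (R / 2 ^ k)) y" for k y
    have le: "ennreal (norm (x - y) powr (- s)) * indicator (cball x R) y \<le> (\<Sum>k. g k y)" for y
    proof (cases "y \<in> cball x R \<and> y \<noteq> x")
      case True
      define t where "t = norm (x - y)"
      have t: "0 < t" "t \<le> R"
        using True by (auto simp: t_def dist_norm)
      have "\<exists>k. R / 2 ^ Suc k < t"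
      proof -
        obtain k where "(1 / 2) ^ k < t / R"
          using real_arch_pow_inv[of "t / R" "1 / 2"] t \<open>0 < R\<close> by auto
        then have "R / 2 ^ k < t"
          using \<open>0 < R\<close> by (simp add: power_divide field_simps)
        moreover have "R / 2 ^ Suc k \<le> R / 2 ^ k"
          using \<open>0 < R\<close> by (simp add: field_simps)
        ultimately show ?thesis by (meson le_less_trans)
      qed
      then obtain k where k: "R / 2 ^ Suc k < t" "\<And>j. j < k \<Longrightarrow> \<not> R / 2 ^ Suc j < t"
        using exists_least_iff[of "\<lambda>k. R / 2 ^ Suc k < t"] by blast
      have "t \<le> R / 2 ^ k"
      proof (cases k)
        case 0
        then show ?thesis using t by simp
      next
        case (Suc j)
        then show ?thesis using k(2)[of j] by simp
      qed
      moreover have "t powr (- s) \<le> (R / 2 ^ Suc k) powr (- s)"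
        using k(1) \<open>0 < R\<close> \<open>0 \<le> s\<close> by (intro powr_mono2') auto
      ultimately have "ennreal (norm (x - y) powr (- s)) * indicator (cball x R) y \<le> g k y"
        using True by (auto simp: g_def t_def[symmetric] dist_norm intro: ennreal_leI)
      also have "\<dots> \<le> (\<Sum>k. g k y)"
        using sum_le_suminf[of "\<lambda>k. g k y" "{k}"] by simp
      finally show ?thesis .
    qed auto
    have int_g: "(\<integral>\<^sup>+y. g k y \<partial>lborel) = ennreal (A * \<theta> ^ k)" for k
    proof -
      have "(\<integral>\<^sup>+y. g k y \<partial>lborel) = ennreal ((R / 2 ^ Suc k) powr (- s)) * emeasure lborel (cball x (R / 2 ^ k))"
        unfolding g_def by (rule nn_integral_cmult_indicator) simp
      also have "\<dots> = ennreal ((R / 2 ^ Suc k) powr (- s) * (unit_ball_vol (real DIM('a)) * (R / 2 ^ k) ^ DIM('a)))"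
        using \<open>0 < R\<close> by (simp add: emeasure_cball ennreal_mult')
      also have "(R / 2 ^ Suc k) powr (- s) * (unit_ball_vol (real DIM('a)) * (R / 2 ^ k) ^ DIM('a)) = A * \<theta> ^ k"
      proof -
        have "(R / 2 ^ Suc k) powr (- s) = (R / 2 / 2 ^ k) powr (- s)"
          by simp
        also have "\<dots> = (R / 2) powr (- s) / (2 ^ k) powr (- s)"
          by (rule powr_divide)
        also have "(2 ^ k :: real) powr (- s) = 1 / (2 powr s) ^ k"
          by (simp add: powr_minus powr_powr mult.commute divide_inverse flip: powr_realpow)
        finally have "(R / 2 ^ Suc k) powr (- s) = (R / 2) powr (- s) * (2 powr s) ^ k"
          by simp
        moreover have "(2 ^ k :: real) ^ DIM('a) = (2 ^ DIM('a)) ^ k"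
          by (simp add: mult.commute flip: power_mult)
        ultimately show ?thesis
          by (simp add: A_def \<theta>_def power_divide)
      qed
      finally show ?thesis .
    qed
    have "(\<integral>\<^sup>+y. ennreal (norm (x - y) powr (- s)) * indicator (cball x R) y \<partial>lborel) \<le>
        (\<integral>\<^sup>+y. (\<Sum>k. g k y) \<partial>lborel)"
      by (intro nn_integral_mono le)
    also have "\<dots> = (\<Sum>k. (\<integral>\<^sup>+y. g k y \<partial>lborel))"
    proof (rule nn_integral_suminf)
      show "g k \<in> borel_measurable lborel" for k
        unfolding g_def
        by (intro borel_measurable_times_ennreal borel_measurable_const borel_measurable_indicator) simp
    qed
    also have "\<dots> = (\<Sum>k. ennreal (A * \<theta> ^ k))"
      by (simp add: int_g)
    also have "\<dots> = ennreal (A * (1 / (1 - \<theta>)))"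
    proof (rule suminf_ennreal_eq)
      show "(\<lambda>k. A * \<theta> ^ k) sums (A * (1 / (1 - \<theta>)))"
        using \<theta> by (intro sums_mult[OF geometric_sums]) simp
    qed (use A \<theta> in simp)
    finally show "(\<integral>\<^sup>+y. ennreal (norm (x - y) powr (- s)) * indicator (cball x R) y \<partial>lborel) \<le>
        ennreal (A * (1 / (1 - \<theta>)))" .
  qed
qed

lemma nn_integral_norm_powr_bounded_set:
  fixes \<Omega> :: "'a::euclidean_space set" and s :: real
  assumes "bounded \<Omega>" "0 \<le> s" "s < real DIM('a)"
  obtains C where "0 \<le> C"
    "\<And>x. x \<in> \<Omega> \<Longrightarrow> (\<integral>\<^sup>+y\<in>\<Omega>. ennreal (norm (x - y) powr (- s)) \<partial>lborel) \<le> ennreal C"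
proof -
  obtain R0 where R0: "\<And>x. x \<in> \<Omega> \<Longrightarrow> norm x \<le> R0" "0 < R0"
    using assms(1) unfolding bounded_pos by blast
  obtain C where C: "0 \<le> C" "\<And>x::'a. (\<integral>\<^sup>+y. ennreal (norm (x - y) powr (- s)) * indicator (cball x (2 * R0)) y \<partial>lborel) \<le> ennreal C"
    using nn_integral_norm_powr_bound[OF assms(2,3), of "2 * R0"] R0(2) by auto
  show thesis
  proof (rule that[OF C(1)])
    fix x assume "x \<in> \<Omega>"
    then have "\<Omega> \<subseteq> cball x (2 * R0)"
      using add_mono[OF R0(1) R0(1), of x]
      by (auto simp: dist_norm intro!: order_trans[OF norm_triangle_ineq4])
    then have "(\<integral>\<^sup>+y\<in>\<Omega>. ennreal (norm (x - y) powr (- s)) \<partial>lborel) \<le>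
        (\<integral>\<^sup>+y. ennreal (norm (x - y) powr (- s)) * indicator (cball x (2 * R0)) y \<partial>lborel)"
      by (intro nn_integral_mono mult_left_mono) (auto simp: indicator_def)
    also have "\<dots> \<le> ennreal C" by (rule C)
    finally show "(\<integral>\<^sup>+y\<in>\<Omega>. ennreal (norm (x - y) powr (- s)) \<partial>lborel) \<le> ennreal C" .
  qed
qed

section \<open>Composition of two Riesz potentials\<close>

text \<open>Young's inequality \<open>c \<le> \<omega> c\<^sup>p + \<omega>\<^bsup>-1/(p-1)\<^esup>\<close> with \<open>p = 13/5\<close> and the weight
  \<open>\<omega> = (X Y)\<^sup>a\<close>; it replaces the composition of Riesz potentials and Hoelder's inequality.\<close>

lemma weighted_young:
  fixes X Y a b c :: real
  assumes "0 \<le> X" "0 \<le> Y" "0 \<le> c"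
  shows "X powr (- b) * Y powr (- b) * c \<le>
    (X powr (- (2 * (b - a))) + Y powr (- (2 * (b - a)))) * c powr (13/5) +
    X powr (- (b + 5/8 * a)) * Y powr (- (b + 5/8 * a))"
proof (cases "0 < X \<and> 0 < Y")
  case False
  then have "X powr (- b) * Y powr (- b) * c = 0" using assms by auto
  then show ?thesis by (simp only:) simp
next
  case True
  then have XY: "0 < X" "0 < Y" by auto
  show ?thesis
  proof (cases "c \<le> (X * Y) powr (- (5/8 * a))")
    \<comment> \<open>Young's inequality by cases, with weight \<omega> = (X Y)^a. Below the
      threshold \<omega>^(-5/8) the second term alone dominates c; above it \<omega> c^(8/5) \<ge>
      1, so the first one does.\<close>
    case True
    have "X powr (- b) * Y powr (- b) * c \<le> X powr (- b) * Y powr (- b) * (X * Y) powr (- (5/8 * a))"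
      using True by (intro mult_left_mono) auto
    also have "\<dots> = X powr (- (b + 5/8 * a)) * Y powr (- (b + 5/8 * a))"
    proof -
      have "t powr (- (b + 5/8 * a)) = t powr (- b) * t powr (- (5/8 * a))" for t
        by (simp flip: powr_add)
      then show ?thesis using XY by (simp only: powr_mult mult_ac)
    qed
    finally show ?thesis by (simp add: add_increasing)
  next
    case False
    then have c: "0 < c" using less_le_trans[OF _ assms(3)] powr_ge_zero[of "X * Y"] by (smt (verit))
    have "(X * Y) powr (- (5/8 * a)) \<le> c" using False by simp
    then have "((X * Y) powr (- (5/8 * a))) powr (8/5) \<le> c powr (8/5)"
      by (intro powr_mono2) auto
    then have "(X * Y) powr (- a) \<le> c powr (8/5)"
      by (simp add: powr_powr)
    then have "(X * Y) powr a * (X * Y) powr (- a) * c \<le> (X * Y) powr a * c powr (8/5) * c"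
      using c by (intro mult_right_mono mult_left_mono) auto
    also have "(X * Y) powr a * (X * Y) powr (- a) = 1"
      using XY by (simp flip: powr_add)
    also have "(X * Y) powr a * c powr (8/5) * c = (X * Y) powr a * c powr (13/5)"
      using c powr_mult_base[of c "8/5"] by (simp add: mult_ac)
    finally have "X powr (- b) * Y powr (- b) * c \<le> X powr (- b) * Y powr (- b) * ((X * Y) powr a * c powr (13/5))"
      by (intro mult_left_mono) auto
    also have "\<dots> = (X powr (a - b) * Y powr (a - b)) * c powr (13/5)"
    proof -
      have "t powr (a - b) = t powr (- b) * t powr a" for t
        by (simp flip: powr_add)
      then show ?thesis using XY by (simp only: powr_mult mult_ac)
    qed
    \<comment> \<open>Separating the two kernels doubles the exponent, but each resulting term
      contains only one kernel, so a single integration over the intermediate variable handles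
      it.\<close>
    also have "\<dots> \<le> ((X powr (a - b))\<^sup>2 + (Y powr (a - b))\<^sup>2) * c powr (13/5)"
    proof (rule mult_right_mono)
      have "0 \<le> X powr (a - b) * Y powr (a - b)" by simp
      then show "X powr (a - b) * Y powr (a - b) \<le> (X powr (a - b))\<^sup>2 + (Y powr (a - b))\<^sup>2"
        using sum_squares_bound[of "X powr (a - b)" "Y powr (a - b)"] by linarith
    qed simp
    also have "(X powr (a - b))\<^sup>2 = X powr (- (2 * (b - a)))"
      by (simp add: power2_eq_square flip: powr_add)
    also have "(Y powr (a - b))\<^sup>2 = Y powr (- (2 * (b - a)))"
      by (simp add: power2_eq_square flip: powr_add)
    finally show ?thesis by (simp add: add_increasing2)
  qed
qed

lemma double_potential_bound:
  fixes \<Omega> :: "'a::euclidean_space set"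
  assumes \<Omega>: "open \<Omega>" "bounded \<Omega>" and dim: "2 \<le> DIM('a)" "DIM('a) \<le> 10"
  defines "\<beta> \<equiv> max 1 (real DIM('a) - 2)"
  obtains C where "0 \<le> C" "\<And>x0 f. x0 \<in> \<Omega> \<Longrightarrow> f \<in> borel_measurable borel \<Longrightarrow> \<forall>z. 0 \<le> f z \<Longrightarrow>
    (\<integral>\<^sup>+y\<in>\<Omega>. (\<integral>\<^sup>+z\<in>\<Omega>. ennreal (norm (x0 - y) powr (- \<beta>) * norm (y - z) powr (- \<beta>) * f z) \<partial>lborel) \<partial>lborel)
    \<le> ennreal C * (1 + (\<integral>\<^sup>+z\<in>\<Omega>. ennreal (f z powr (13/5)) \<partial>lborel))"
proof -
  \<comment> \<open>Both new exponents must stay below N. For \<beta> = N - 2 this means N/2 - 2 < a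
    < 16/5, a nonempty range exactly for N < 52/5 = 4p. The value 31/10 lies in it up to N = 10; the
    minimum with \<beta> keeps \<sigma> nonnegative in low dimensions.\<close>
  define a where "a = min \<beta> (31/10)"
  define \<sigma> where "\<sigma> = 2 * (\<beta> - a)"
  define \<tau> where "\<tau> = \<beta> + 5/8 * a"
  have \<sigma>: "0 \<le> \<sigma>" "\<sigma> < real DIM('a)" and \<tau>: "0 \<le> \<tau>" "\<tau> < real DIM('a)"
  proof -
    consider "DIM('a) = 2" | "3 \<le> DIM('a)" using dim by linarith
    then have "0 \<le> \<sigma> \<and> \<sigma> < real DIM('a) \<and> 0 \<le> \<tau> \<and> \<tau> < real DIM('a)"
    proof cases
      case 1
      then show ?thesis by (simp add: \<sigma>_def \<tau>_def a_def \<beta>_def)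
    next
      case 2
      then have N: "3 \<le> real DIM('a)" "real DIM('a) \<le> 10" using dim by auto
      then have "\<beta> = real DIM('a) - 2" by (simp add: \<beta>_def)
      with N show ?thesis by (auto simp: \<sigma>_def \<tau>_def a_def min_def)
    qed
    then show "0 \<le> \<sigma>" "\<sigma> < real DIM('a)" "0 \<le> \<tau>" "\<tau> < real DIM('a)" by auto
  qed
  have [measurable]: "\<Omega> \<in> sets borel" using \<Omega> by simp
  obtain C\<sigma> where C\<sigma>: "0 \<le> C\<sigma>"
    "\<And>x. x \<in> \<Omega> \<Longrightarrow> (\<integral>\<^sup>+y\<in>\<Omega>. ennreal (norm (x - y) powr (- \<sigma>)) \<partial>lborel) \<le> ennreal C\<sigma>"
    by (rule nn_integral_norm_powr_bounded_set[OF \<Omega>(2) \<sigma>]) (rule that)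
  obtain C\<tau> where C\<tau>: "0 \<le> C\<tau>"
    "\<And>x. x \<in> \<Omega> \<Longrightarrow> (\<integral>\<^sup>+y\<in>\<Omega>. ennreal (norm (x - y) powr (- \<tau>)) \<partial>lborel) \<le> ennreal C\<tau>"
    by (rule nn_integral_norm_powr_bounded_set[OF \<Omega>(2) \<tau>]) (rule that)
  define C where "C = max (2 * C\<sigma>) (C\<tau> * C\<tau>)"
  show thesis
  proof (rule that[of C])
    show "0 \<le> C" using C\<sigma>(1) by (simp add: C_def le_max_iff_disj)
    fix x0 :: 'a and f :: "'a \<Rightarrow> real"
    assume x0: "x0 \<in> \<Omega>" and f[measurable]: "f \<in> borel_measurable borel" and f0: "\<forall>z. 0 \<le> f z"
    define F where "F z = ennreal (f z powr (13/5)) * indicator \<Omega> z" for z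
    define P where "P s x y = ennreal (norm (x - y) powr (- s)) * indicator \<Omega> y" for s and x y :: 'a
    have [measurable]: "F \<in> borel_measurable borel" unfolding F_def by measurable
    have [measurable]: "(\<lambda>(x, y). P s x y) \<in> borel_measurable (borel \<Otimes>\<^sub>M borel)" for s
      unfolding P_def by measurable
    let ?I = "\<integral>\<^sup>+z. F z \<partial>lborel"
    have pw: "ennreal (norm (x0 - y) powr (- \<beta>) * norm (y - z) powr (- \<beta>) * f z) * indicator \<Omega> z * indicator \<Omega> y \<le>
        P \<sigma> x0 y * F z + P \<sigma> z y * F z + P \<tau> x0 y * P \<tau> y z" for y z
    proof (cases "y \<in> \<Omega> \<and> z \<in> \<Omega>")
      case True
      have "ennreal (norm (x0 - y) powr (- \<beta>) * norm (y - z) powr (- \<beta>) * f z) \<le>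
        ennreal ((norm (x0 - y) powr (- \<sigma>) + norm (y - z) powr (- \<sigma>)) * f z powr (13/5) +
          norm (x0 - y) powr (- \<tau>) * norm (y - z) powr (- \<tau>))"
        unfolding \<sigma>_def \<tau>_def by (intro ennreal_leI weighted_young norm_ge_zero f0[rule_format])
      also have "\<dots> = P \<sigma> x0 y * F z + P \<sigma> z y * F z + P \<tau> x0 y * P \<tau> y z"
        using True by (simp add: P_def F_def ennreal_mult distrib_right norm_minus_commute[of z y])
      finally show ?thesis using True by simp
    qed auto
    have P\<sigma>: "(\<integral>\<^sup>+y. P \<sigma> x y \<partial>lborel) \<le> ennreal C\<sigma>" if "x \<in> \<Omega>" for x
      using C\<sigma>(2)[OF that] by (simp add: P_def)
    have P\<tau>: "(\<integral>\<^sup>+y. P \<tau> x y \<partial>lborel) \<le> ennreal C\<tau>" if "x \<in> \<Omega>" for x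
      using C\<tau>(2)[OF that] by (simp add: P_def)
    have T1: "(\<integral>\<^sup>+y. (\<integral>\<^sup>+z. P \<sigma> x0 y * F z \<partial>lborel) \<partial>lborel) \<le> ennreal C\<sigma> * ?I"
    proof -
      have "(\<integral>\<^sup>+y. (\<integral>\<^sup>+z. P \<sigma> x0 y * F z \<partial>lborel) \<partial>lborel) = (\<integral>\<^sup>+y. P \<sigma> x0 y \<partial>lborel) * ?I"
        by (simp add: nn_integral_cmult nn_integral_multc)
      then show ?thesis
        using P\<sigma>[OF x0] by (simp add: mult_right_mono)
    qed
    have T2: "(\<integral>\<^sup>+y. (\<integral>\<^sup>+z. P \<sigma> z y * F z \<partial>lborel) \<partial>lborel) \<le> ennreal C\<sigma> * ?I"
    proof -
      \<comment> \<open>The kernel joins both variables, while \<open>F\<close> depends on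
        \<open>z\<close> alone; integrating in \<open>y\<close> first leaves just the mass of the
        source.\<close>
      have "(\<integral>\<^sup>+y. (\<integral>\<^sup>+z. P \<sigma> z y * F z \<partial>lborel) \<partial>lborel) = (\<integral>\<^sup>+z. (\<integral>\<^sup>+y. P \<sigma> z y * F z \<partial>lborel) \<partial>lborel)"
        by (rule lborel_pair.Fubini'[symmetric]) measurable
      also have "\<dots> = (\<integral>\<^sup>+z. (\<integral>\<^sup>+y. P \<sigma> z y \<partial>lborel) * F z \<partial>lborel)"
        by (intro nn_integral_cong nn_integral_multc) measurable
      also have "\<dots> \<le> (\<integral>\<^sup>+z. ennreal C\<sigma> * F z \<partial>lborel)"
      proof (rule nn_integral_mono)
        fix z
        show "(\<integral>\<^sup>+y. P \<sigma> z y \<partial>lborel) * F z \<le> ennreal C\<sigma> * F z"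
          using P\<sigma>[of z] by (cases "z \<in> \<Omega>") (auto simp: F_def intro: mult_right_mono)
      qed
      also have "\<dots> = ennreal C\<sigma> * ?I"
        by (rule nn_integral_cmult) measurable
      finally show ?thesis .
    qed
    have T3: "(\<integral>\<^sup>+y. (\<integral>\<^sup>+z. P \<tau> x0 y * P \<tau> y z \<partial>lborel) \<partial>lborel) \<le> ennreal C\<tau> * ennreal C\<tau>"
    proof -
      have "(\<integral>\<^sup>+y. (\<integral>\<^sup>+z. P \<tau> x0 y * P \<tau> y z \<partial>lborel) \<partial>lborel) = (\<integral>\<^sup>+y. P \<tau> x0 y * (\<integral>\<^sup>+z. P \<tau> y z \<partial>lborel) \<partial>lborel)"
        by (intro nn_integral_cong nn_integral_cmult) measurable
      also have "\<dots> \<le> (\<integral>\<^sup>+y. P \<tau> x0 y * ennreal C\<tau> \<partial>lborel)"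
      proof (rule nn_integral_mono)
        fix y
        show "P \<tau> x0 y * (\<integral>\<^sup>+z. P \<tau> y z \<partial>lborel) \<le> P \<tau> x0 y * ennreal C\<tau>"
          using P\<tau>[of y] by (cases "y \<in> \<Omega>") (auto simp: P_def[of \<tau> x0] intro: mult_left_mono)
      qed
      also have "\<dots> = (\<integral>\<^sup>+y. P \<tau> x0 y \<partial>lborel) * ennreal C\<tau>"
        by (rule nn_integral_multc) measurable
      also have "\<dots> \<le> ennreal C\<tau> * ennreal C\<tau>"
        by (intro mult_right_mono P\<tau>[OF x0]) simp
      finally show ?thesis .
    qed
    have "(\<integral>\<^sup>+y\<in>\<Omega>. (\<integral>\<^sup>+z\<in>\<Omega>. ennreal (norm (x0 - y) powr (- \<beta>) * norm (y - z) powr (- \<beta>) * f z) \<partial>lborel) \<partial>lborel) =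
       (\<integral>\<^sup>+y. (\<integral>\<^sup>+z. ennreal (norm (x0 - y) powr (- \<beta>) * norm (y - z) powr (- \<beta>) * f z) * indicator \<Omega> z * indicator \<Omega> y \<partial>lborel) \<partial>lborel)"
      by (intro nn_integral_cong nn_integral_multc[symmetric]) measurable
    also have "\<dots> \<le> (\<integral>\<^sup>+y. (\<integral>\<^sup>+z. P \<sigma> x0 y * F z + P \<sigma> z y * F z + P \<tau> x0 y * P \<tau> y z \<partial>lborel) \<partial>lborel)"
      by (intro nn_integral_mono pw)
    also have "\<dots> = (\<integral>\<^sup>+y. (\<integral>\<^sup>+z. P \<sigma> x0 y * F z \<partial>lborel) + (\<integral>\<^sup>+z. P \<sigma> z y * F z \<partial>lborel) +
        (\<integral>\<^sup>+z. P \<tau> x0 y * P \<tau> y z \<partial>lborel) \<partial>lborel)"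
      by (intro nn_integral_cong) (simp add: nn_integral_add)
    also have "\<dots> = (\<integral>\<^sup>+y. (\<integral>\<^sup>+z. P \<sigma> x0 y * F z \<partial>lborel) \<partial>lborel) +
        (\<integral>\<^sup>+y. (\<integral>\<^sup>+z. P \<sigma> z y * F z \<partial>lborel) \<partial>lborel) +
        (\<integral>\<^sup>+y. (\<integral>\<^sup>+z. P \<tau> x0 y * P \<tau> y z \<partial>lborel) \<partial>lborel)"
      by (simp add: nn_integral_add)
    also have "\<dots> \<le> ennreal C\<sigma> * ?I + ennreal C\<sigma> * ?I + ennreal C\<tau> * ennreal C\<tau>"
      by (intro add_mono T1 T2 T3)
    also have "\<dots> = ennreal (2 * C\<sigma>) * ?I + ennreal (C\<tau> * C\<tau>) * 1"
    proof -
      have "ennreal (2 * C\<sigma>) = ennreal C\<sigma> + ennreal C\<sigma>"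
        using C\<sigma>(1) by (subst mult_2) (intro ennreal_plus)
      moreover have "ennreal (C\<tau> * C\<tau>) = ennreal C\<tau> * ennreal C\<tau>"
        using C\<tau>(1) by (intro ennreal_mult)
      ultimately show ?thesis
        by (simp only: distrib_right mult_1_right)
    qed
    also have "\<dots> \<le> ennreal C * ?I + ennreal C * 1"
      by (intro add_mono mult_right_mono ennreal_leI) (auto simp: C_def)
    also have "\<dots> = ennreal C * (1 + (\<integral>\<^sup>+z\<in>\<Omega>. ennreal (f z powr (13/5)) \<partial>lborel))"
      by (simp add: F_def distrib_left add.commute)
    finally show "(\<integral>\<^sup>+y\<in>\<Omega>. (\<integral>\<^sup>+z\<in>\<Omega>. ennreal (norm (x0 - y) powr (- \<beta>) * norm (y - z) powr (- \<beta>) * f z) \<partial>lborel) \<partial>lborel)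
      \<le> ennreal C * (1 + (\<integral>\<^sup>+z\<in>\<Omega>. ennreal (f z powr (13/5)) \<partial>lborel))" .
  qed
qed

subsection \<open>Uniform bound along the minimal branch\<close>

text \<open>The minimum principle wants a strict sign of the Laplacian, so \<open>V\<close> is first
  shown to be strictly positive inside.\<close>

lemma gelfand_solution_nonneg:
  fixes \<Omega> :: "'a::euclidean_space set"
  assumes \<Omega>: "open \<Omega>" "bounded \<Omega>" and l: "0 < l" and sys: "gelfand_system \<Omega> l U V"
  shows "0 \<le> U x"
proof -
  obtain G G' where G: "has_grad_lap \<Omega> U G (\<lambda>x. - V x)" "has_grad_lap \<Omega> V G' (\<lambda>x. - (l * exp (U x)))"
    using gelfand_systemD(5,6)[OF sys] by blast
  have "0 < V x" if "x \<in> \<Omega>" for x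
    by (rule strong_min_principle[OF \<Omega>(2,1) gelfand_systemD(2,4)[OF sys] G(2) _ that]) (use l in auto)
  then show ?thesis
    by (intro min_principle[OF \<Omega>(2,1) gelfand_systemD(1,3)[OF sys] G(1)]) auto
qed

text \<open>\<open>potential_bound\<close> is applied to \<open>U\<close> with source
  \<open>V\<close>, and under the integral to \<open>V\<close> with source l exp U. This produces
  the double potential, which the L^p bound of the source controls. The second solution
  \<open>U'\<close> serves to make \<open>U\<close> stable.\<close>

lemma gelfand_uniform_bound:
  fixes \<Omega> :: "'a::euclidean_space set"
  assumes \<Omega>: "open \<Omega>" "bounded \<Omega>" and dim: "2 \<le> DIM('a)" "DIM('a) \<le> 10" and "0 < m"
  obtains M where "\<And>l l' U V U' V' x. 0 < l \<Longrightarrow> l < l' \<Longrightarrow> l \<le> m \<Longrightarrow>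
    gelfand_system \<Omega> l U V \<Longrightarrow> gelfand_system \<Omega> l' U' V' \<Longrightarrow> \<forall>x\<in>\<Omega>. U x < U' x \<Longrightarrow>
    x \<in> \<Omega> \<Longrightarrow> U x \<le> M"
proof -
  define \<beta> where "\<beta> = max 1 (real DIM('a) - 2)"
  have \<beta>: "0 \<le> \<beta>" "\<beta> < real DIM('a)"
    using dim by (auto simp: \<beta>_def)
  obtain C0 where C0: "\<And>l U V. 0 < l \<Longrightarrow> l \<le> m \<Longrightarrow> gelfand_system \<Omega> l U V \<Longrightarrow> stable_solution \<Omega> l U \<Longrightarrow>
    (\<integral>\<^sup>+x\<in>\<Omega>. ennreal ((l * exp (U x)) powr (13/5)) \<partial>lborel) \<le> ennreal C0"
    by (rule gelfand_source_bound[OF \<Omega> \<open>0 < m\<close>]) (rule that)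
  obtain C1 where C1: "0 < C1" "\<And>w h G x0. continuous_on UNIV w \<Longrightarrow> \<forall>x. x \<notin> \<Omega> \<longrightarrow> w x = 0 \<Longrightarrow>
    has_grad_lap \<Omega> w G (\<lambda>x. - h x) \<Longrightarrow> \<forall>x\<in>\<Omega>. 0 \<le> h x \<Longrightarrow> x0 \<in> \<Omega> \<Longrightarrow>
    ennreal (w x0) \<le> ennreal C1 *
      (1 + (\<integral>\<^sup>+y\<in>\<Omega>. ennreal (norm (x0 - y) powr (- \<beta>) * h y) \<partial>lborel))"
    by (rule potential_bound[OF \<Omega> dim(1), folded \<beta>_def]) (rule that)
  obtain C2 where C2: "0 \<le> C2" "\<And>x0 f. x0 \<in> \<Omega> \<Longrightarrow> f \<in> borel_measurable borel \<Longrightarrow> \<forall>z. 0 \<le> f z \<Longrightarrow>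
    (\<integral>\<^sup>+y\<in>\<Omega>. (\<integral>\<^sup>+z\<in>\<Omega>. ennreal (norm (x0 - y) powr (- \<beta>) * norm (y - z) powr (- \<beta>) * f z) \<partial>lborel) \<partial>lborel)
    \<le> ennreal C2 * (1 + (\<integral>\<^sup>+z\<in>\<Omega>. ennreal (f z powr (13/5)) \<partial>lborel))"
    by (rule double_potential_bound[OF \<Omega> dim, folded \<beta>_def]) (rule that)
  obtain C3 where C3: "0 \<le> C3"
    "\<And>x. x \<in> \<Omega> \<Longrightarrow> (\<integral>\<^sup>+y\<in>\<Omega>. ennreal (norm (x - y) powr (- \<beta>)) \<partial>lborel) \<le> ennreal C3"
    by (rule nn_integral_norm_powr_bounded_set[OF \<Omega>(2) \<beta>]) (rule that)
  have [measurable]: "\<Omega> \<in> sets borel" using \<Omega> by simp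
  define B where "B = ennreal C1 * (1 + ennreal C1 * (ennreal C3 + ennreal C2 * (1 + ennreal C0)))"
  have B: "B < \<infinity>"
    unfolding B_def by (simp add: ennreal_mult_less_top)
  show thesis
  proof (rule that[of "enn2real B"])
    fix l l' U V U' V' x
    assume l: "0 < l" "l < l'" "l \<le> m" and sys: "gelfand_system \<Omega> l U V" "gelfand_system \<Omega> l' U' V'"
      and less: "\<forall>x\<in>\<Omega>. U x < U' x" and x: "x \<in> \<Omega>"
    obtain G G' where G: "has_grad_lap \<Omega> U G (\<lambda>x. - V x)" "has_grad_lap \<Omega> V G' (\<lambda>x. - (l * exp (U x)))"
      using gelfand_systemD(5,6)[OF sys(1)] by blast
    define k where "k x y = norm (x - y) powr (- \<beta>)" for x y :: 'a
    define f where "f z = l * exp (U z)" for z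
    have f: "0 \<le> f z" for z using l by (simp add: f_def)
    have [measurable]: "U \<in> borel_measurable borel"
      using gelfand_systemD(1)[OF sys(1)] by (rule borel_measurable_continuous_onI)
    have fm[measurable]: "f \<in> borel_measurable borel"
      unfolding f_def by measurable
    have km[measurable]: "(\<lambda>(x, y). k x y) \<in> borel_measurable (borel \<Otimes>\<^sub>M borel)"
      unfolding k_def by measurable
    have V: "0 \<le> V y" for y by (rule gelfand_laplacian_nonneg[OF \<Omega> l(1) sys(1)])
    have source: "(\<integral>\<^sup>+x\<in>\<Omega>. ennreal (f x powr (13/5)) \<partial>lborel) \<le> ennreal C0"
      unfolding f_def
      by (rule C0[OF l(1,3) sys(1)]) (rule gelfand_stability[OF \<Omega> l(1,2) sys less[rule_format]])
    have kV: "ennreal (k x y * V y) * indicator \<Omega> y \<le>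
        ennreal C1 * (ennreal (k x y) * indicator \<Omega> y +
          (\<integral>\<^sup>+z\<in>\<Omega>. ennreal (k x y * k y z * f z) \<partial>lborel) * indicator \<Omega> y)" for y
    proof (cases "y \<in> \<Omega>")
      case True
      have "ennreal (V y) \<le> ennreal C1 * (1 + (\<integral>\<^sup>+z\<in>\<Omega>. ennreal (k y z * f z) \<partial>lborel))"
        unfolding k_def f_def
        using l by (intro C1(2)[OF gelfand_systemD(2)[OF sys(1)] _ G(2) _ True])
          (auto simp: gelfand_systemD(4)[OF sys(1)])
      then have "ennreal (k x y) * ennreal (V y) \<le>
          ennreal (k x y) * (ennreal C1 * (1 + (\<integral>\<^sup>+z\<in>\<Omega>. ennreal (k y z * f z) \<partial>lborel)))"
        by (rule mult_left_mono) simp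
      also have "\<dots> = ennreal C1 * (ennreal (k x y) +
          ennreal (k x y) * (\<integral>\<^sup>+z\<in>\<Omega>. ennreal (k y z * f z) \<partial>lborel))"
        by (simp add: distrib_left mult_ac)
      also have "ennreal (k x y) * (\<integral>\<^sup>+z\<in>\<Omega>. ennreal (k y z * f z) \<partial>lborel) =
          (\<integral>\<^sup>+z. ennreal (k x y) * (ennreal (k y z * f z) * indicator \<Omega> z) \<partial>lborel)"
        by (rule nn_integral_cmult[symmetric]) measurable
      also have "\<dots> = (\<integral>\<^sup>+z\<in>\<Omega>. ennreal (k x y * k y z * f z) \<partial>lborel)"
        by (intro nn_integral_cong) (simp add: k_def f ennreal_mult' mult_ac)
      finally show ?thesis
        using True V by (simp add: k_def ennreal_mult)
    qed simp
    have "ennreal (U x) \<le> ennreal C1 * (1 + (\<integral>\<^sup>+y\<in>\<Omega>. ennreal (k x y * V y) \<partial>lborel))"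
      unfolding k_def
      by (intro C1(2)[OF gelfand_systemD(1)[OF sys(1)] _ G(1) _ x])
        (auto simp: gelfand_systemD(3)[OF sys(1)] V)
    also have "(\<integral>\<^sup>+y\<in>\<Omega>. ennreal (k x y * V y) \<partial>lborel) \<le>
        (\<integral>\<^sup>+y. ennreal C1 * (ennreal (k x y) * indicator \<Omega> y +
          (\<integral>\<^sup>+z\<in>\<Omega>. ennreal (k x y * k y z * f z) \<partial>lborel) * indicator \<Omega> y) \<partial>lborel)"
      by (intro nn_integral_mono kV)
    also have "\<dots> = ennreal C1 * ((\<integral>\<^sup>+y\<in>\<Omega>. ennreal (k x y) \<partial>lborel) +
        (\<integral>\<^sup>+y\<in>\<Omega>. (\<integral>\<^sup>+z\<in>\<Omega>. ennreal (k x y * k y z * f z) \<partial>lborel) \<partial>lborel))"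
      by (simp add: nn_integral_cmult nn_integral_add)
    also have "\<dots> \<le> ennreal C1 * (ennreal C3 + ennreal C2 * (1 + ennreal C0))"
    proof (intro mult_left_mono add_mono)
      show "(\<integral>\<^sup>+y\<in>\<Omega>. ennreal (k x y) \<partial>lborel) \<le> ennreal C3"
        unfolding k_def by (rule C3(2)[OF x])
      have "(\<integral>\<^sup>+y\<in>\<Omega>. (\<integral>\<^sup>+z\<in>\<Omega>. ennreal (k x y * k y z * f z) \<partial>lborel) \<partial>lborel) \<le>
          ennreal C2 * (1 + (\<integral>\<^sup>+z\<in>\<Omega>. ennreal (f z powr (13/5)) \<partial>lborel))"
        unfolding k_def using f by (intro C2(2)[OF x fm]) simp
      also have "\<dots> \<le> ennreal C2 * (1 + ennreal C0)"
        by (intro mult_left_mono add_left_mono source) simp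
      finally show "(\<integral>\<^sup>+y\<in>\<Omega>. (\<integral>\<^sup>+z\<in>\<Omega>. ennreal (k x y * k y z * f z) \<partial>lborel) \<partial>lborel) \<le>
          ennreal C2 * (1 + ennreal C0)" .
    qed simp
    finally have "ennreal (U x) \<le> B"
      by (simp add: B_def mult_left_mono add_left_mono)
    then have "enn2real (ennreal (U x)) \<le> enn2real B"
      using B by (intro enn2real_mono) auto
    then show "U x \<le> enn2real B"
      using gelfand_solution_nonneg[OF \<Omega> l(1) sys(1)] by simp
  qed
qed

section \<open>The dimension bound and passage to the extremal solution\<close>

lemma dimension_at_most_10:
  assumes "real n < 2 + 4 * sqrt 2 + 4 * sqrt (2 - sqrt 2)"
  shows "n \<le> 10"
proof -
  \<comment> \<open>The two rational bounds give 2 + 4 * 1.415 + 4 * 0.78 = 10.78 < 11, enough for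
    an integer dimension.\<close>
  have up: "sqrt 2 < 1415/1000"
    by (rule real_less_lsqrt) (simp_all add: power2_eq_square)
  have "(14/10)\<^sup>2 \<le> (2::real)"
    by (simp add: power2_eq_square)
  then have "14/10 \<le> sqrt 2"
    by (rule real_le_rsqrt)
  then have "2 - sqrt 2 < (78/100)\<^sup>2"
    by (simp add: power2_eq_square)
  then have "sqrt (2 - sqrt 2) < 78/100"
    using real_less_lsqrt[of "78/100" "2 - sqrt 2"] by simp
  then show ?thesis using assms up by linarith
qed

theorem theorem1:
  fixes \<Omega> :: "'a::euclidean_space set"
    and lstar :: real
    and u :: "real \<Rightarrow> 'a \<Rightarrow> real"
    and ustar :: "'a \<Rightarrow> ereal"
  assumes domain: "smooth_bounded_domain \<Omega>"
    and dim_ge: "DIM('a) \<ge> 2"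
    and dim_less: "real DIM('a) < 2 + 4 * sqrt 2 + 4 * sqrt (2 - sqrt 2)"
    and lstar: "extremal_parameter exp \<Omega> = ereal lstar" "0 < lstar"
    and minimal: "\<And>l. 0 < l \<Longrightarrow> l < lstar \<Longrightarrow> minimal_navier_solution exp \<Omega> l (u l)"
    and increasing: "\<And>x. x \<in> \<Omega> \<Longrightarrow> strict_mono_on {0<..<lstar} (\<lambda>l. u l x)"
    and extremal: "is_extremal_solution lstar \<Omega> u ustar"
  shows "in_L_infinity \<Omega> ustar"
proof -
  have \<Omega>: "open \<Omega>" "bounded \<Omega>"
    using domain by (auto simp: smooth_bounded_domain_def)
  have sol: "navier_solution exp \<Omega> l (u l)" if "0 < l" "l < lstar" for l
    using minimal[OF that] by (simp add: minimal_navier_solution_def)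
  obtain M where M: "\<And>l l' U V U' V' x. 0 < l \<Longrightarrow> l < l' \<Longrightarrow> l \<le> lstar \<Longrightarrow>
    gelfand_system \<Omega> l U V \<Longrightarrow> gelfand_system \<Omega> l' U' V' \<Longrightarrow> \<forall>x\<in>\<Omega>. U x < U' x \<Longrightarrow>
    x \<in> \<Omega> \<Longrightarrow> U x \<le> M"
    using gelfand_uniform_bound[OF \<Omega> dim_ge dimension_at_most_10[OF dim_less] lstar(2)] by blast
  have bound: "0 \<le> u l x" "u l x \<le> M" if l: "0 < l" "l < lstar" and x: "x \<in> \<Omega>" for l x
  proof -
    \<comment> \<open>Any larger parameter below \<open>lstar\<close> would do: its solution lies
      strictly above and provides the positive supersolution behind stability.\<close>
    define l' where "l' = (l + lstar) / 2"
    have l': "0 < l'" "l < l'" "l' < lstar"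
      using l by (auto simp: l'_def)
    obtain U V where U: "gelfand_system \<Omega> l U V" "\<And>x. x \<in> \<Omega> \<Longrightarrow> U x = u l x"
      using navier_solution_imp_gelfand_system[OF \<Omega>(1) sol[OF l]] by blast
    obtain U' V' where U': "gelfand_system \<Omega> l' U' V'" "\<And>x. x \<in> \<Omega> \<Longrightarrow> U' x = u l' x"
      using navier_solution_imp_gelfand_system[OF \<Omega>(1) sol[OF l'(1,3)]] by blast
    have "U x < U' x" if "x \<in> \<Omega>" for x
      using strict_mono_onD[OF increasing[OF that], of l l'] l l' that by (simp add: U U')
    then have "U x \<le> M"
      using l by (intro M[OF l(1) l'(2) _ U(1) U'(1) _ x]) auto
    then show "u l x \<le> M"
      using U(2)[OF x] by simp
    show "0 \<le> u l x"
      using gelfand_solution_nonneg[OF \<Omega> l(1) U(1), of x] U(2)[OF x] by simp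
  qed
  have lim: "((\<lambda>l. ereal (u l x)) \<longlongrightarrow> ustar x) (at_left lstar)" if "x \<in> \<Omega>" for x
    using extremal that by (simp add: is_extremal_solution_def)
  have ev: "eventually (\<lambda>l. 0 < l \<and> l < lstar) (at_left lstar)"
    using eventually_at_left_real[OF lstar(2)] by eventually_elim auto
  have ustar: "0 \<le> ustar x" "ustar x \<le> ereal M" if x: "x \<in> \<Omega>" for x
  proof -
    show "0 \<le> ustar x"
      by (rule tendsto_lowerbound[OF lim[OF x]]) (use ev in \<open>auto elim!: eventually_mono intro: bound x\<close>)
    show "ustar x \<le> ereal M"
      by (rule tendsto_upperbound[OF lim[OF x]]) (use ev in \<open>auto elim!: eventually_mono intro: bound x\<close>)
  qed
  \<comment> \<open>Measurability of the limit needs a sequence in place of the filter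
    \<open>at_left lstar\<close>. The shift by 2 makes already the first member positive.\<close>
  define t where "t n = lstar - lstar / real (n + 2)" for n
  have t: "0 < t n" "t n < lstar" for n
  proof -
    have "lstar / real (n + 2) < lstar / 1"
      using lstar(2) by (intro divide_strict_left_mono) auto
    moreover have "0 < lstar / real (n + 2)"
      using lstar(2) by (intro divide_pos_pos) auto
    ultimately show "0 < t n" "t n < lstar" by (simp_all add: t_def)
  qed
  have "(\<lambda>n. lstar - lstar / real (n + 2)) \<longlonglongrightarrow> lstar - 0"
    by (intro tendsto_intros tendsto_divide_0[OF tendsto_const] filterlim_at_top_imp_at_infinity
        filterlim_compose[OF filterlim_real_sequentially] filterlim_add_const_nat_at_top)
  then have t_lim: "filterlim t (at_left lstar) sequentially"
    unfolding filterlim_at using t by (auto simp: t_def[abs_def] less_imp_neq)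
  have "ustar \<in> borel_measurable (lebesgue_on \<Omega>)"
  proof (rule borel_measurable_LIMSEQ_order)
    show "(\<lambda>n. ereal (u (t n) x)) \<longlonglongrightarrow> ustar x" if "x \<in> space (lebesgue_on \<Omega>)" for x
      using that by (intro filterlim_compose[OF lim t_lim]) simp
    fix n
    have "continuous_on \<Omega> (u (t n))"
      using sol[OF t] closure_subset
      unfolding navier_solution_def smooth_on_closure_def by (blast intro: continuous_on_subset)
    then have "u (t n) \<in> borel_measurable (lebesgue_on \<Omega>)"
      using \<Omega>(1) by (intro continuous_imp_measurable_on_sets_lebesgue) auto
    then show "(\<lambda>x. ereal (u (t n) x)) \<in> borel_measurable (lebesgue_on \<Omega>)"
      by measurable
  qed
  moreover have "AE x in lebesgue_on \<Omega>. \<bar>ustar x\<bar> \<le> ereal M"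
    using ustar by (intro AE_I2) auto
  ultimately show ?thesis
    unfolding in_L_infinity_def by blast
qed

end
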